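(* Suppose $\mathcal{K}\subset\mathbb{X}_d$ is a compact set and every domain in $\overline{\mathrm{Aff}(\mathbb{C}^d)\cdot\mathcal{K}}\cap\mathbb{X}_d$ has simple boundary. Then for any $R>0$ there exist $C>0$ and $m\ge1$ such that $$\delta_\Omega(z;v)\le C\,\delta_\Omega(z)^{1/m}$$ for all $\Omega\in\mathcal{K}$, all $z\in\Omega$ with $\|z\|<R$, and all non-zero $v\in\mathbb{C}^d$.
   Context: A convex domain in $\mathbb{C}^d$ is $\mathbb{C}$-properly convex if it contains no entire complex affine line. $\mathbb{X}_d$ is the set of all non-empty $\mathbb{C}$-properly convex domains in $\mathbb{C}^d$, with the local Hausdorff topology: $\Omega_n\to\Omega$ in $\mathbb{X}_d$ if there is $R_0\ge0$ such that for all $R\ge R_0$ the Hausdorff distance between $\overline{\Omega}_n\cap\overline{B(0;R)}$ and $\overline{\Omega}\cap\overline{B(0;R)}$ tends to $0$, where $B(0;R)$ is the Euclidean ball (the Hausdorff distance between the empty set and a non-empty set is $\infty$). $\mathrm{Aff}(\mathbb{C}^d)$ is the group of complex affine automorphisms of $\mathbb{C}^d$, acting on $\mathbb{X}_d$; $\overline{\mathrm{Aff}(\mathbb{C}^d)\cdot\mathcal{K}}\cap\mathbb{X}_d$ is the set of all $\mathcal{D}\in\mathbb{X}_d$ that are limits in $\mathbb{X}_d$ of sequences $A_n\Omega_n$ with $A_n\in\mathrm{Aff}(\mathbb{C}^d)$, $\Omega_n\in\mathcal{K}$. A domain has simple boundary if every holomorphic map from the unit disk $\mathbb{D}\subset\mathbb{C}$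 into its boundary is constant. For $z\in\Omega$ and $v\in\mathbb{C}^d\setminus\{0\}$: $\delta_\Omega(z)=\inf\{\|z-w\|:w\in\partial\Omega\}$ and $\delta_\Omega(z;v)=\inf\{\|z-w\|:w\in\partial\Omega\cap(z+\mathbb{C}\cdot v)\}$. *)

theory Defs
  imports "HOL-Complex_Analysis.Complex_Analysis"
begin

definition complex_line :: "complex ^ 'd \<Rightarrow> complex ^ 'd \<Rightarrow> (complex ^ 'd) set" where
  "complex_line z v = range (\<lambda>c. z + c *s v)"

definition C_properly_convex_domains :: "(complex ^ 'd::finite) set set" where
  "C_properly_convex_domains =
     {\<Omega>. open \<Omega> \<and> convex \<Omega> \<and> \<Omega> \<noteq> {} \<and> (\<forall>z v. v \<noteq> 0 \<longrightarrow> \<not> complex_line z v \<subseteq> \<Omega>)}"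

text \<open>In \<^typ>\<open>ennreal\<close> the supremum of the empty set is \<open>0\<close> and its infimum is \<open>\<infinity>\<close>, so the distance
  between the empty set and a non-empty set is \<open>\<infinity>\<close>, and that of the empty set to itself is \<open>0\<close>.\<close>

definition hausdorff_distance :: "'a::metric_space set \<Rightarrow> 'a set \<Rightarrow> ennreal" where
  "hausdorff_distance A B =
     max (SUP a\<in>A. INF b\<in>B. ennreal (dist a b)) (SUP b\<in>B. INF a\<in>A. ennreal (dist a b))"

definition local_hausdorff_converges ::
    "(nat \<Rightarrow> (complex ^ 'd::finite) set) \<Rightarrow> (complex ^ 'd) set \<Rightarrow> bool" where
  "local_hausdorff_converges \<Omega>s \<Omega> \<longleftrightarrow>
     (\<exists>R0\<ge>0. \<forall>R\<ge>R0.
        (\<lambda>n. hausdorff_distance (closure (\<Omega>s n) \<inter> cball 0 R) (closure \<Omega> \<inter> cball 0 R))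
          \<longlonglongrightarrow> 0)"

text \<open>The local Hausdorff topology is given by its convergent sequences and is metrizable, so its
  open sets are exactly the sequentially open ones.\<close>

definition local_hausdorff_topology :: "(complex ^ 'd::finite) set topology" where
  "local_hausdorff_topology = topology (\<lambda>U. U \<subseteq> C_properly_convex_domains \<and>
     (\<forall>\<Omega>s \<Omega>. range \<Omega>s \<subseteq> C_properly_convex_domains \<longrightarrow> \<Omega> \<in> U \<longrightarrow>
        local_hausdorff_converges \<Omega>s \<Omega> \<longrightarrow> eventually (\<lambda>n. \<Omega>s n \<in> U) sequentially))"

lemma openin_local_hausdorff_topology:
  "openin local_hausdorff_topology U \<longleftrightarrow> U \<subseteq> C_properly_convex_domains \<and>
     (\<forall>\<Omega>s \<Omega>. range \<Omega>s \<subseteq> C_properly_convex_domains \<longrightarrow> \<Omega> \<in> U \<longrightarrow>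
        local_hausdorff_converges \<Omega>s \<Omega> \<longrightarrow> eventually (\<lambda>n. \<Omega>s n \<in> U) sequentially)"
    (is "_ \<longleftrightarrow> ?P U")
proof -
  have "istopology ?P"
    unfolding istopology_def
  proof (intro conjI allI impI)
    fix S T \<Omega>s \<Omega>
    assume ST: "?P S" "?P T"
    show "S \<inter> T \<subseteq> C_properly_convex_domains" using ST by blast
    assume *: "range \<Omega>s \<subseteq> C_properly_convex_domains" "\<Omega> \<in> S \<inter> T" "local_hausdorff_converges \<Omega>s \<Omega>"
    have "eventually (\<lambda>n. \<Omega>s n \<in> S) sequentially" "eventually (\<lambda>n. \<Omega>s n \<in> T) sequentially"
      using ST * by (blast, blast)
    then show "eventually (\<lambda>n. \<Omega>s n \<in> S \<inter> T) sequentially"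
      by eventually_elim simp
  next
    fix \<U> \<Omega>s \<Omega>
    assume U: "\<forall>S\<in>\<U>. ?P S"
    show "\<Union>\<U> \<subseteq> C_properly_convex_domains" using U by blast
    assume *: "range \<Omega>s \<subseteq> C_properly_convex_domains" "\<Omega> \<in> \<Union>\<U>" "local_hausdorff_converges \<Omega>s \<Omega>"
    then obtain S where S: "S \<in> \<U>" "\<Omega> \<in> S" by blast
    then have "eventually (\<lambda>n. \<Omega>s n \<in> S) sequentially" using U * by blast
    then show "eventually (\<lambda>n. \<Omega>s n \<in> \<Union>\<U>) sequentially"
      by eventually_elim (use S in blast)
  qed
  then show ?thesis
    unfolding local_hausdorff_topology_def by (simp add: topology_inverse')
qed

lemma topspace_local_hausdorff_topology:
  "topspace local_hausdorff_topology = C_properly_convex_domains"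
proof -
  have "openin local_hausdorff_topology C_properly_convex_domains"
    unfolding openin_local_hausdorff_topology by (auto intro!: always_eventually)
  moreover have "topspace local_hausdorff_topology \<subseteq> C_properly_convex_domains"
    using openin_topspace openin_local_hausdorff_topology by blast
  ultimately show ?thesis
    using openin_subset by blast
qed

definition affine_automorphisms :: "(complex ^ 'd \<Rightarrow> complex ^ 'd::finite) set" where
  "affine_automorphisms = {T. \<exists>A b. invertible A \<and> T = (\<lambda>x. A *v x + b)}"

definition affine_orbit_closure :: "(complex ^ 'd::finite) set set \<Rightarrow> (complex ^ 'd) set set" where
  "affine_orbit_closure K =
     {D \<in> C_properly_convex_domains.
        \<exists>T \<Omega>s. (\<forall>n::nat. T n \<in> affine_automorphisms \<and> \<Omega>s n \<in> K) \<and>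
          local_hausdorff_converges (\<lambda>n. T n ` \<Omega>s n) D}"

definition simple_boundary :: "(complex ^ 'd::finite) set \<Rightarrow> bool" where
  "simple_boundary \<Omega> \<longleftrightarrow>
     (\<forall>f. (\<forall>i. (\<lambda>\<zeta>. f \<zeta> $ i) holomorphic_on ball 0 1) \<longrightarrow> f ` ball 0 1 \<subseteq> frontier \<Omega> \<longrightarrow>
        f constant_on ball 0 1)"

text \<open>For \<open>\<Omega>\<close> in \<^const>\<open>C_properly_convex_domains\<close>, \<open>z \<in> \<Omega>\<close> and \<open>v \<noteq> 0\<close>, the line
  \<^term>\<open>complex_line z v\<close> meets the boundary of \<open>\<Omega>\<close>, so the convention \<^term>\<open>infdist z {} = 0\<close> never
  comes into play.\<close>

definition boundary_distance :: "(complex ^ 'd::finite) set \<Rightarrow> complex ^ 'd \<Rightarrow> real" where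
  "boundary_distance \<Omega> z = infdist z (frontier \<Omega>)"

definition directional_boundary_distance ::
    "(complex ^ 'd::finite) set \<Rightarrow> complex ^ 'd \<Rightarrow> complex ^ 'd \<Rightarrow> real" where
  "directional_boundary_distance \<Omega> z v = infdist z (frontier \<Omega> \<inter> complex_line z v)"

end

(* An affine-invariant doubling property drives the proof: moving from a boundary point
   \<xi> towards the interior by a uniform factor M along a nontangential segment, the radius of a
   complex affine disc in any direction at least doubles. Otherwise, with M tending to infinity,
   affine maps bring the counterexamples to a position in which the
   domains contain a fixed ball and their balanced parts are uniformly bounded; the Minkowski
   gauges then have a convergent subsequence, whose limit is the gauge of a domain in the closure of
   the orbit with a nonconstant affine disc through the limit of the \<xi> in its boundary. Compactness
   of K enters only through a uniform inner ball and a uniform bound on the discs at its centre.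
   Iterating the doubling along the segment joining the boundary to this centre
   gives the exponent 1 / m with m = log 2 M. *)

theory Submission
  imports Defs
begin

section \<open>Gauges of convex sets\<close>

locale bounded_gauge =
  fixes p :: "'a::real_normed_vector \<Rightarrow> real" and r :: real
  assumes radius_pos: "r > 0"
    and nonneg: "0 \<le> p x"
    and scale: "0 \<le> t \<Longrightarrow> p (t *\<^sub>R x) = t * p x"
    and subadd: "p (x + y) \<le> p x + p y"
    and bound: "p x \<le> norm x / r"
begin

lemma zero: "p 0 = 0"
  using scale[of 0 0] by simp

lemma diff_le: "\<bar>p x - p y\<bar> \<le> norm (x - y) / r"
proof -
  have "p x \<le> p y + norm (x - y) / r" for x y
    using subadd[of y "x - y"] bound[of "x - y"] by simp
  from this[of x y] this[of y x] show ?thesis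
    by (simp add: norm_minus_commute abs_le_iff)
qed

lemma continuous: "continuous_on S p"
proof (rule continuous_on_subset[OF _ subset_UNIV])
  have "(1/r)-lipschitz_on UNIV p"
    using diff_le radius_pos by (intro lipschitz_onI) (auto simp: dist_norm)
  then show "continuous_on UNIV p"
    by (rule lipschitz_on_continuous_on)
qed

lemma open_sublevel: "open {x. p x < 1}"
  by (intro open_Collect_less continuous continuous_on_const)

lemma convex_sublevel: "convex {x. p x < 1}"
proof (rule convexI, clarsimp)
  fix x y u v assume *: "p x < 1" "p y < 1" "0 \<le> u" "0 \<le> v" "u + v = (1::real)"
  have "p (u *\<^sub>R x + v *\<^sub>R y) \<le> u * p x + v * p y"
    using subadd[of "u *\<^sub>R x" "v *\<^sub>R y"] * by (simp add: scale)
  also have "\<dots> < 1"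
    using convex_bound_lt[of "p x" 1 "p y" u v] * by simp
  finally show "p (u *\<^sub>R x + v *\<^sub>R y) < 1" .
qed

lemma closure_sublevel: "closure {x. p x < 1} = {x. p x \<le> 1}"
proof
  have "closed {x. p x \<le> 1}"
    by (intro closed_Collect_le continuous continuous_on_const)
  then show "closure {x. p x < 1} \<subseteq> {x. p x \<le> 1}"
    by (intro closure_minimal) auto
  show "{x. p x \<le> 1} \<subseteq> closure {x. p x < 1}"
  proof clarify
    fix x assume x: "p x \<le> 1"
    have "(\<lambda>n. (1 - inverse (real (Suc n))) *\<^sub>R x) \<longlonglongrightarrow> (1 - 0) *\<^sub>R x"
      by (intro tendsto_intros LIMSEQ_inverse_real_of_nat)
    moreover have "(1 - inverse (real (Suc n))) *\<^sub>R x \<in> {x. p x < 1}" for n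
    proof -
      have 0: "0 \<le> 1 - inverse (real (Suc n))" "1 - inverse (real (Suc n)) < 1"
        by (auto simp: field_simps)
      have "p ((1 - inverse (real (Suc n))) *\<^sub>R x) = (1 - inverse (real (Suc n))) * p x"
        using 0 by (simp add: scale)
      also have "\<dots> \<le> (1 - inverse (real (Suc n))) * 1"
        using 0 x by (intro mult_left_mono) auto
      also have "\<dots> < 1" using 0 by simp
      finally show ?thesis by simp
    qed
    ultimately show "x \<in> closure {x. p x < 1}"
      unfolding closure_sequential by (auto intro!: exI[of _ "\<lambda>n. (1 - inverse (real (Suc n))) *\<^sub>R x"])
  qed
qed

lemma frontier_sublevel: "frontier {x. p x < 1} = {x. p x = 1}"
  unfolding frontier_def closure_sublevel interior_open[OF open_sublevel] by auto

end

definition minkowski_gauge :: "'a::real_normed_vector set \<Rightarrow> 'a \<Rightarrow> real" where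
  "minkowski_gauge S x = Inf {t. 0 < t \<and> x /\<^sub>R t \<in> S}"

locale gauged_set =
  fixes S :: "'a::real_normed_vector set" and r :: real
  assumes open_set: "open S" and convex_set: "convex S" and r_pos: "0 < r" and ball_subset: "ball 0 r \<subseteq> S"
begin

lemma bdd_below_scalings: "bdd_below {t::real. 0 < t \<and> x /\<^sub>R t \<in> S}"
  by (rule bdd_belowI[of _ 0]) auto

lemma large_scaling_mem: "norm x / r < t \<Longrightarrow> t \<in> {t. 0 < t \<and> x /\<^sub>R t \<in> S}"
proof -
  assume t: "norm x / r < t"
  then have "0 < t" using r_pos by (smt (verit) divide_nonneg_pos norm_ge_zero)
  moreover have "x /\<^sub>R t \<in> ball 0 r"
    using t r_pos \<open>0 < t\<close> by (simp add: field_simps)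
  ultimately show ?thesis using ball_subset by auto
qed

lemma scalings_nonempty: "{t::real. 0 < t \<and> x /\<^sub>R t \<in> S} \<noteq> {}"
  using large_scaling_mem[of x "norm x / r + 1"] by auto

lemma gauge_le: "0 < t \<Longrightarrow> x /\<^sub>R t \<in> S \<Longrightarrow> minkowski_gauge S x \<le> t"
  unfolding minkowski_gauge_def by (intro cInf_lower bdd_below_scalings) auto

lemma gauge_lessE:
  assumes "minkowski_gauge S x < u"
  obtains t where "0 < t" "t < u" "x /\<^sub>R t \<in> S"
  using cInf_lessD[OF scalings_nonempty assms[unfolded minkowski_gauge_def]] by auto

lemma zero_mem: "0 \<in> S"
  using r_pos ball_subset by auto

lemma gauge_less_1_iff: "minkowski_gauge S x < 1 \<longleftrightarrow> x \<in> S"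
proof
  assume "minkowski_gauge S x < 1"
  then obtain t where t: "0 < t" "t < 1" "x /\<^sub>R t \<in> S" by (rule gauge_lessE)
  have "t *\<^sub>R (x /\<^sub>R t) + (1 - t) *\<^sub>R 0 \<in> S"
    using t zero_mem by (intro convexD[OF convex_set]) auto
  then show "x \<in> S" using t by simp
next
  assume x: "x \<in> S"
  have "((\<lambda>t. x /\<^sub>R t) \<longlongrightarrow> x /\<^sub>R 1) (at_left 1)"
    by (intro tendsto_intros) auto
  then have "eventually (\<lambda>t. x /\<^sub>R t \<in> S) (at_left 1)"
    using topological_tendstoD[OF _ open_set, of "\<lambda>t. x /\<^sub>R t" "x /\<^sub>R 1"] x by simp
  moreover have "eventually (\<lambda>t. (t::real) \<in> {0<..<1}) (at_left 1)"
    by (rule eventually_at_left_real) simp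
  ultimately have "eventually (\<lambda>t. x /\<^sub>R t \<in> S \<and> t \<in> {0<..<1}) (at_left (1::real))"
    by (rule eventually_conj)
  then obtain t where "x /\<^sub>R t \<in> S" "t \<in> {0<..<(1::real)}"
    using eventually_happens'[OF trivial_limit_at_left_real] by blast
  then show "minkowski_gauge S x < 1"
    using gauge_le[of t x] by auto
qed

lemma bounded_gauge: "bounded_gauge (minkowski_gauge S) r"
proof
  show "0 < r" by (rule r_pos)
  show nn: "0 \<le> minkowski_gauge S x" for x
    unfolding minkowski_gauge_def by (rule cInf_greatest[OF scalings_nonempty]) auto
  show bd: "minkowski_gauge S x \<le> norm x / r" for x
  proof (rule field_le_epsilon)
    fix e :: real assume "0 < e"
    then show "minkowski_gauge S x \<le> norm x / r + e"
      using large_scaling_mem[of x "norm x / r + e"] by (intro gauge_le) auto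
  qed
  have le: "minkowski_gauge S (t *\<^sub>R x) \<le> t * minkowski_gauge S x" if t: "0 < t" for t x
  proof (rule field_le_epsilon)
    fix e :: real assume e: "0 < e"
    have "minkowski_gauge S x < minkowski_gauge S x + e / t" using e t by simp
    then obtain s where s: "0 < s" "s < minkowski_gauge S x + e / t" "x /\<^sub>R s \<in> S"
      by (rule gauge_lessE)
    then have "minkowski_gauge S (t *\<^sub>R x) \<le> t * s"
      using t by (intro gauge_le) (auto simp: field_simps)
    also have "\<dots> \<le> t * (minkowski_gauge S x + e / t)"
      using s t by (intro mult_left_mono) auto
    also have "\<dots> = t * minkowski_gauge S x + e"
      using t by (simp add: distrib_left)
    finally show "minkowski_gauge S (t *\<^sub>R x) \<le> t * minkowski_gauge S x + e" .
  qed
  show "minkowski_gauge S (t *\<^sub>R x) = t * minkowski_gauge S x" if t: "0 \<le> t" for t x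
  proof (cases "t = 0")
    case True
    then show ?thesis using nn[of 0] bd[of 0] by simp
  next
    case False
    with t have "0 < t" by simp
    have "t * minkowski_gauge S x = t * minkowski_gauge S (inverse t *\<^sub>R t *\<^sub>R x)"
      using \<open>0 < t\<close> by simp
    also have "\<dots> \<le> t * (inverse t * minkowski_gauge S (t *\<^sub>R x))"
      using \<open>0 < t\<close> by (intro mult_left_mono le) auto
    also have "\<dots> = minkowski_gauge S (t *\<^sub>R x)"
      using \<open>0 < t\<close> by (simp flip: mult.assoc)
    finally show ?thesis
      using le[OF \<open>0 < t\<close>, of x] by simp
  qed
  show "minkowski_gauge S (x + y) \<le> minkowski_gauge S x + minkowski_gauge S y" for x y
  proof (rule field_le_epsilon)
    fix e :: real assume e: "0 < e"
    obtain s where s: "0 < s" "s < minkowski_gauge S x + e / 2" "x /\<^sub>R s \<in> S"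
      by (rule gauge_lessE[of x "minkowski_gauge S x + e / 2"]) (use e in auto)
    obtain t where t: "0 < t" "t < minkowski_gauge S y + e / 2" "y /\<^sub>R t \<in> S"
      by (rule gauge_lessE[of y "minkowski_gauge S y + e / 2"]) (use e in auto)
    have "(s / (s + t)) *\<^sub>R (x /\<^sub>R s) + (t / (s + t)) *\<^sub>R (y /\<^sub>R t) \<in> S"
      using s t by (intro convexD[OF convex_set]) (auto simp flip: add_divide_distrib)
    also have "(s / (s + t)) *\<^sub>R (x /\<^sub>R s) + (t / (s + t)) *\<^sub>R (y /\<^sub>R t) = (x + y) /\<^sub>R (s + t)"
    proof -
      have "s / (s + t) * inverse s = inverse (s + t)" "t / (s + t) * inverse t = inverse (s + t)"
        using s(1) t(1) by (auto simp: divide_inverse)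
      then show ?thesis by (simp only: scaleR_scaleR scaleR_right_distrib)
    qed
    finally have "minkowski_gauge S (x + y) \<le> s + t"
      using s t by (intro gauge_le) auto
    then show "minkowski_gauge S (x + y) \<le> minkowski_gauge S x + minkowski_gauge S y + e"
      using s t by simp
  qed
qed

end

section \<open>Hausdorff convergence of sublevel sets\<close>

lemma hausdorff_distance_leI:
  assumes "\<And>a. a \<in> A \<Longrightarrow> \<exists>b\<in>B. dist a b \<le> e" "\<And>b. b \<in> B \<Longrightarrow> \<exists>a\<in>A. dist a b \<le> e"
  shows "hausdorff_distance A B \<le> ennreal e"
  unfolding hausdorff_distance_def
proof (intro max.boundedI SUP_least)
  fix a assume "a \<in> A"
  with assms(1) obtain b where "b \<in> B" "dist a b \<le> e" by blast
  then show "(INF b\<in>B. ennreal (dist a b)) \<le> ennreal e"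
    by (intro INF_lower2[of b] ennreal_leI)
next
  fix b assume "b \<in> B"
  with assms(2) obtain a where "a \<in> A" "dist a b \<le> e" by blast
  then show "(INF a\<in>A. ennreal (dist a b)) \<le> ennreal e"
    by (intro INF_lower2[of a] ennreal_leI)
qed

lemma hausdorff_distance_lessD:
  assumes "hausdorff_distance A B < ennreal e"
  shows "a \<in> A \<Longrightarrow> \<exists>b\<in>B. dist a b < e" "b \<in> B \<Longrightarrow> \<exists>a\<in>A. dist a b < e"
proof -
  have e: "ennreal t < ennreal e \<Longrightarrow> t < e" for t
    by (metis ennreal_leI not_le)
  show "\<exists>b\<in>B. dist a b < e" if a: "a \<in> A"
  proof -
    have "(INF b\<in>B. ennreal (dist a b)) \<le> (SUP a\<in>A. INF b\<in>B. ennreal (dist a b))"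
      using a by (rule SUP_upper)
    also have "\<dots> \<le> hausdorff_distance A B" unfolding hausdorff_distance_def by (rule max.cobounded1)
    also note assms
    finally obtain b where "b \<in> B" "ennreal (dist a b) < ennreal e"
      unfolding INF_less_iff by blast
    then show ?thesis using e by blast
  qed
  show "\<exists>a\<in>A. dist a b < e" if b: "b \<in> B"
  proof -
    have "(INF a\<in>A. ennreal (dist a b)) \<le> (SUP b\<in>B. INF a\<in>A. ennreal (dist a b))"
      using b by (rule SUP_upper)
    also have "\<dots> \<le> hausdorff_distance A B" unfolding hausdorff_distance_def by (rule max.cobounded2)
    also note assms
    finally obtain a where "a \<in> A" "ennreal (dist a b) < ennreal e"
      unfolding INF_less_iff by blast
    then show ?thesis using e by blast
  qed
qed

lemma hausdorff_sublevel_le: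
  fixes p q :: "'a::real_normed_vector \<Rightarrow> real"
  assumes p: "bounded_gauge p r" and q: "bounded_gauge q s" and e: "0 \<le> e" and R: "0 \<le> R"
    and le: "\<And>x. \<bar>p x - q x\<bar> \<le> e * norm x"
  shows "hausdorff_distance (closure {x. p x < 1} \<inter> cball 0 R) (closure {x. q x < 1} \<inter> cball 0 R)
    \<le> ennreal (e * R * R)"
proof -
  have key: "\<exists>y\<in>closure {x. q x < 1} \<inter> cball 0 R. dist x y \<le> e * R * R"
    if p: "bounded_gauge p r" and q: "bounded_gauge q s" and le: "\<And>x. \<bar>p x - q x\<bar> \<le> e * norm x"
      and x: "x \<in> closure {x. p x < 1} \<inter> cball 0 R"
    for p q :: "'a \<Rightarrow> real" and r s x
  proof -
    interpret p: bounded_gauge p r by fact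
    interpret q: bounded_gauge q s by fact
    have px: "p x \<le> 1" and xR: "norm x \<le> R" using x by (auto simp: p.closure_sublevel)
    have eR: "0 \<le> e * R" using e R by simp
    define y where "y = inverse (1 + e * R) *\<^sub>R x"
    have "e * norm x \<le> e * R" using xR e by (rule mult_left_mono)
    then have "q x \<le> 1 + e * R" using le[of x] px by linarith
    then have "q y \<le> 1"
      using eR unfolding y_def by (subst q.scale) (auto simp: field_simps)
    moreover have "norm y \<le> R"
    proof -
      have "norm y \<le> 1 * norm x"
        unfolding y_def norm_scaleR using eR by (intro mult_right_mono) (auto simp: field_simps)
      then show ?thesis using xR by simp
    qed
    moreover have "dist x y \<le> e * R * R"
    proof -
      have "x - y = (e * R / (1 + e * R)) *\<^sub>R x"
      proof -
        have "x - y = (1 - inverse (1 + e * R)) *\<^sub>R x"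
          by (simp add: y_def scaleR_left_diff_distrib)
        also have "1 - inverse (1 + e * R) = e * R / (1 + e * R)"
          using eR by (simp add: field_simps)
        finally show ?thesis .
      qed
      then have "dist x y = e * R / (1 + e * R) * norm x"
        using eR by (simp add: dist_norm)
      also have "\<dots> \<le> e * R * R"
        using eR xR R by (intro mult_mono) (auto simp: field_simps)
      finally show ?thesis .
    qed
    ultimately show ?thesis by (auto simp: q.closure_sublevel)
  qed
  show ?thesis
  proof (rule hausdorff_distance_leI)
    show "\<exists>b\<in>closure {x. q x < 1} \<inter> cball 0 R. dist a b \<le> e * R * R"
      if "a \<in> closure {x. p x < 1} \<inter> cball 0 R" for a
      using key[OF p q le that] .
    show "\<exists>a\<in>closure {x. p x < 1} \<inter> cball 0 R. dist a b \<le> e * R * R"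
      if "b \<in> closure {x. q x < 1} \<inter> cball 0 R" for b
      using key[OF q p _ that] le by (auto simp: dist_commute abs_minus_commute)
  qed
qed

lemma local_hausdorff_converges_sublevel:
  fixes p :: "nat \<Rightarrow> complex ^ 'd::finite \<Rightarrow> real"
  assumes p: "\<And>n. bounded_gauge (p n) r" and q: "bounded_gauge q r"
    and lim: "\<And>e. 0 < e \<Longrightarrow> \<exists>N. \<forall>n\<ge>N. \<forall>x. \<bar>p n x - q x\<bar> \<le> e * norm x"
  shows "local_hausdorff_converges (\<lambda>n. {x. p n x < 1}) {x. q x < 1}"
  unfolding local_hausdorff_converges_def
proof (intro exI[of _ 0] conjI allI impI)
  fix R :: real assume R: "0 \<le> R"
  show "(\<lambda>n. hausdorff_distance (closure {x. p n x < 1} \<inter> cball 0 R)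
      (closure {x. q x < 1} \<inter> cball 0 R)) \<longlonglongrightarrow> 0"
  proof (rule order_tendstoI)
    fix a :: ennreal assume "0 < a"
    obtain e where e: "0 < e" "ennreal e < a"
    proof (cases a)
      case (real t)
      with \<open>0 < a\<close> have "0 < t" by simp
      with real show ?thesis
        by (intro that[of "t / 2"]) (auto simp: ennreal_less_iff)
    next
      case top
      show ?thesis by (rule that[of 1]) (simp_all add: top)
    qed
    have RR: "0 < R * R + 1" using R by (intro add_nonneg_pos) auto
    with lim[of "e / (R * R + 1)"] e obtain N
      where N: "\<And>n x. n \<ge> N \<Longrightarrow> \<bar>p n x - q x\<bar> \<le> e / (R * R + 1) * norm x" by auto
    have "hausdorff_distance (closure {x. p n x < 1} \<inter> cball 0 R) (closure {x. q x < 1} \<inter> cball 0 R) < a"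
      if "n \<ge> N" for n
    proof -
      have "hausdorff_distance (closure {x. p n x < 1} \<inter> cball 0 R) (closure {x. q x < 1} \<inter> cball 0 R)
        \<le> ennreal (e / (R * R + 1) * R * R)"
        using e RR R N[OF that] by (intro hausdorff_sublevel_le[OF p q]) auto
      also have "\<dots> \<le> ennreal e"
        using e RR R by (intro ennreal_leI) (auto simp: field_simps)
      also have "\<dots> < a" by fact
      finally show ?thesis .
    qed
    then show "eventually (\<lambda>n. hausdorff_distance (closure {x. p n x < 1} \<inter> cball 0 R)
      (closure {x. q x < 1} \<inter> cball 0 R) < a) sequentially"
      unfolding eventually_sequentially by blast
  qed auto
qed simp

lemma bounded_gauge_subsequence:
  fixes p :: "nat \<Rightarrow> 'a::euclidean_space \<Rightarrow> real"
  assumes p: "\<And>n. bounded_gauge (p n) r"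
  obtains q k where "bounded_gauge q r" "strict_mono (k :: nat \<Rightarrow> nat)"
    "\<And>x. (\<lambda>n. p (k n) x) \<longlonglongrightarrow> q x"
    "\<And>e. 0 < e \<Longrightarrow> \<exists>N. \<forall>n\<ge>N. \<forall>x. \<bar>p (k n) x - q x\<bar> \<le> e * norm x"
proof -
  have r: "0 < r" using p[of 0] by (rule bounded_gauge.radius_pos)
  obtain g k where g: "continuous_on (sphere 0 1) g" and k: "strict_mono (k :: nat \<Rightarrow> nat)"
    and lim: "\<And>e. 0 < e \<Longrightarrow> \<exists>N. \<forall>n x. n \<ge> N \<and> x \<in> sphere 0 1 \<longrightarrow> norm (p (k n) x - g x) < e"
  proof (rule Arzela_Ascoli[of "sphere 0 1" p "1 / r"])
    show "norm (p n x) \<le> 1 / r" if "x \<in> sphere 0 1" for n x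
      using bounded_gauge.bound[OF p, of n x] bounded_gauge.nonneg[OF p, of n x] that by simp
    show "\<exists>d>0. \<forall>n y. y \<in> sphere 0 1 \<and> norm (x - y) < d \<longrightarrow> norm (p n x - p n y) < e"
      if "0 < e" for x e
    proof (intro exI[of _ "e * r"] conjI allI impI)
      fix n y assume "y \<in> sphere 0 1 \<and> norm (x - y) < e * r"
      then have "norm (x - y) / r < e" using r by (simp add: field_simps)
      then show "norm (p n x - p n y) < e"
        using bounded_gauge.diff_le[OF p, of n x y] by simp
    qed (use that r in simp)
  qed auto
  define q where "q x = norm x * g (x /\<^sub>R norm x)" for x
  have close: "\<exists>N. \<forall>n\<ge>N. \<forall>x. \<bar>p (k n) x - q x\<bar> \<le> e * norm x" if e: "0 < e" for e
  proof -
    obtain N where N: "\<And>n x. n \<ge> N \<Longrightarrow> x \<in> sphere 0 1 \<Longrightarrow> norm (p (k n) x - g x) < e"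
      using lim[OF e] by blast
    have "\<bar>p (k n) x - q x\<bar> \<le> e * norm x" if "n \<ge> N" for n x
    proof (cases "x = 0")
      case True
      then show ?thesis using bounded_gauge.zero[OF p] by (simp add: q_def)
    next
      case False
      have "p (k n) x = p (k n) (norm x *\<^sub>R (x /\<^sub>R norm x))" using False by simp
      also have "\<dots> = norm x * p (k n) (x /\<^sub>R norm x)"
        by (rule bounded_gauge.scale[OF p]) simp
      finally have "\<bar>p (k n) x - q x\<bar> = norm x * \<bar>p (k n) (x /\<^sub>R norm x) - g (x /\<^sub>R norm x)\<bar>"
        by (simp add: q_def abs_mult flip: right_diff_distrib)
      also have "\<dots> \<le> norm x * e"
        using N[OF that, of "x /\<^sub>R norm x"] False by (intro mult_left_mono) auto
      finally show ?thesis by (simp add: mult.commute)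
    qed
    then show ?thesis by blast
  qed
  have ptw: "(\<lambda>n. p (k n) x) \<longlonglongrightarrow> q x" for x
  proof (rule LIMSEQ_I)
    fix e :: real assume e: "0 < e"
    have nx: "0 < norm x + 1" by (simp add: add_nonneg_pos)
    then obtain N where N: "\<forall>n\<ge>N. \<forall>x'. \<bar>p (k n) x' - q x'\<bar> \<le> e / (norm x + 1) * norm x'"
      using close[of "e / (norm x + 1)"] e by auto
    have "e / (norm x + 1) * norm x < e" using e nx by (simp add: field_simps)
    then show "\<exists>N. \<forall>n\<ge>N. norm (p (k n) x - q x) < e"
      using N by (intro exI[of _ N]) (auto intro: order_le_less_trans)
  qed
  have "bounded_gauge q r"
  proof
    show "0 \<le> q x" for x
      by (rule LIMSEQ_le_const[OF ptw]) (use bounded_gauge.nonneg[OF p] in auto)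
    show "q (t *\<^sub>R x) = t * q x" if "0 \<le> t" for t x
      using LIMSEQ_unique[OF ptw[of "t *\<^sub>R x"] tendsto_mult_left[OF ptw[of x], of t,
          folded bounded_gauge.scale[OF p that]]] .
    show "q (x + y) \<le> q x + q y" for x y
      by (rule LIMSEQ_le[OF ptw tendsto_add[OF ptw ptw]]) (use bounded_gauge.subadd[OF p] in auto)
    show "q x \<le> norm x / r" for x
      by (rule LIMSEQ_le_const2[OF ptw]) (use bounded_gauge.bound[OF p] in auto)
  qed fact
  then show ?thesis using k close ptw that by blast
qed

section \<open>Affine normalization\<close>

lemma norm_vector_smult: "norm (c *s v) = norm c * norm (v :: 'a::real_normed_field ^ 'd)"
  unfolding norm_vec_def by (simp add: norm_mult L2_set_right_distrib)

lemma scaleR_eq_vector_smult: "t *\<^sub>R v = of_real t *s (v :: 'a::real_normed_field ^ 'd)"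
  by (simp add: vec_eq_iff scaleR_conv_of_real[of _ "_ :: 'a"])

lemma bounded_bilinear_vector_smult:
  "bounded_bilinear ((*s) :: complex \<Rightarrow> complex ^ 'd \<Rightarrow> complex ^ 'd)"
proof
  show "\<exists>K. \<forall>a b. norm ((a::complex) *s (b :: complex ^ 'd)) \<le> norm a * norm b * K"
    by (intro exI[of _ 1]) (simp add: norm_vector_smult)
qed (auto simp: vec_eq_iff algebra_simps)

lemmas tendsto_vector_smult = bounded_bilinear.tendsto[OF bounded_bilinear_vector_smult]
lemmas continuous_on_vector_smult = bounded_bilinear.continuous_on[OF bounded_bilinear_vector_smult]

lemma vec_norm_le_sum: "norm (x :: 'a::real_normed_vector ^ 'd) \<le> (\<Sum>i\<in>UNIV. norm (x $ i))"
  unfolding norm_vec_def by (rule L2_set_le_sum) simp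

lemma open_convex_closure_combination:
  fixes S :: "'a::euclidean_space set"
  assumes "open S" "convex S" "a \<in> S" "b \<in> closure S" "0 < t" "t \<le> 1"
  shows "b + t *\<^sub>R (a - b) \<in> S"
  using mem_interior_closure_convex_shrink[of S a b t] assms
  by (simp add: interior_open algebra_simps)

lemma open_properly_convex: "\<Omega> \<in> C_properly_convex_domains \<Longrightarrow> open \<Omega>"
  and convex_properly_convex: "\<Omega> \<in> C_properly_convex_domains \<Longrightarrow> convex \<Omega>"
  by (auto simp: C_properly_convex_domains_def)

lemma directional_radius_bounded:
  fixes \<Omega> :: "(complex ^ 'd::finite) set"
  assumes \<Omega>: "\<Omega> \<in> C_properly_convex_domains" and z: "z \<in> \<Omega>"
  shows "\<exists>n::nat. \<forall>v. norm v = 1 \<longrightarrow> (\<exists>c. norm c \<le> real n \<and> z + c *s v \<notin> closure \<Omega>)"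
proof (rule ccontr)
  assume "\<not> ?thesis"
  then have "\<forall>n::nat. \<exists>v. norm v = 1 \<and> (\<forall>c. norm c \<le> real n \<longrightarrow> z + c *s v \<in> closure \<Omega>)"
    by blast
  then obtain v where v: "\<And>n. norm (v n) = 1"
    "\<And>n c. norm c \<le> real n \<Longrightarrow> z + c *s v n \<in> closure \<Omega>" by metis
  have "\<forall>n. v n \<in> sphere 0 1" using v(1) by simp
  then obtain u k where u: "u \<in> sphere 0 1" and k: "strict_mono (k::nat\<Rightarrow>nat)" and lim: "(v \<circ> k) \<longlonglongrightarrow> u"
    using compact_sphere[of "0 :: complex ^ 'd" 1] unfolding compact_def by blast
  have cl: "z + c *s u \<in> closure \<Omega>" for c
  proof (rule Lim_in_closed_set[of _ "\<lambda>n. z + c *s v (k n)" sequentially])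
    obtain N where N: "norm c \<le> real N" using real_arch_simple by blast
    have "z + c *s v (k n) \<in> closure \<Omega>" if "n \<ge> N" for n
    proof (rule v(2))
      have "N \<le> k n" using that seq_suble[OF k, of n] by linarith
      then show "norm c \<le> real (k n)" using N by linarith
    qed
    then show "\<forall>\<^sub>F n in sequentially. z + c *s v (k n) \<in> closure \<Omega>"
      unfolding eventually_sequentially by blast
    show "(\<lambda>n. z + c *s v (k n)) \<longlonglongrightarrow> z + c *s u"
      using lim by (intro tendsto_intros tendsto_vector_smult) (simp add: o_def)
  qed auto
  have "z + c *s u \<in> \<Omega>" for c
  proof -
    have "(z + (2 * c) *s u) + (1/2) *\<^sub>R (z - (z + (2 * c) *s u)) \<in> \<Omega>"
      using \<Omega> z cl by (intro open_convex_closure_combination open_properly_convex convex_properly_convex) auto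
    moreover have "(z + (2 * c) *s u) + (1/2) *\<^sub>R (z - (z + (2 * c) *s u)) = z + c *s u"
      by (simp add: vec_eq_iff scaleR_conv_of_real[of _ "_ :: complex"])
    ultimately show ?thesis by (simp only:)
  qed
  then have "complex_line z u \<subseteq> \<Omega>" by (auto simp: complex_line_def)
  moreover have "u \<noteq> 0" using u by auto
  ultimately show False using \<Omega> by (auto simp: C_properly_convex_domains_def)
qed

lemma continuous_on_det:
  fixes S :: "('a::{real_normed_field} ^ 'n ^ 'n) set"
  shows "continuous_on S det"
  unfolding det_def by (intro continuous_intros)

text \<open>Maximising \<open>\<bar>det\<bar>\<close> over bases chosen from the largest balanced subset of \<open>closure \<Omega> - z\<close>
  gives an Auerbach-type basis: by Cramer's rule this set has coordinates bounded by \<open>1\<close>.\<close>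

lemma affine_normalization:
  fixes \<Omega> :: "(complex ^ 'd::finite) set"
  assumes \<Omega>: "\<Omega> \<in> C_properly_convex_domains" and z: "z \<in> \<Omega>"
  obtains A :: "complex ^ 'd ^ 'd" where "invertible A"
    "ball 0 (1 / (2 * real CARD('d))) \<subseteq> (\<lambda>x. A *v (x - z)) ` \<Omega>"
    "\<And>u. (\<And>c. norm c \<le> 1 \<Longrightarrow> c *s u \<in> (\<lambda>x. A *v (x - z)) ` \<Omega>) \<Longrightarrow> norm u \<le> real CARD('d)"
proof -
  note op = open_properly_convex[OF \<Omega>] and cv = convex_properly_convex[OF \<Omega>]
  define B where "B = {u. \<forall>c. norm c \<le> 1 \<longrightarrow> z + c *s u \<in> closure \<Omega>}"
  have closed_B: "closed B"
  proof -
    have "B = (\<Inter>c\<in>cball 0 1. (\<lambda>u. z + c *s u) -` closure \<Omega>)"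
      by (auto simp: B_def)
    moreover have "closed ((\<lambda>u. z + c *s u) -` closure \<Omega>)" for c
      by (intro closed_vimage continuous_intros continuous_on_vector_smult) auto
    ultimately show ?thesis by auto
  qed
  obtain n where n: "\<And>v. norm v = 1 \<Longrightarrow> \<exists>c. norm c \<le> real n \<and> z + c *s v \<notin> closure \<Omega>"
    using directional_radius_bounded[OF \<Omega> z] by blast
  have norm_B: "norm u \<le> real n" if u: "u \<in> B" for u
  proof (rule ccontr)
    assume "\<not> norm u \<le> real n"
    then have un: "norm u > real n" and u0: "norm u > 0" using of_nat_0_le_iff[of n] by linarith+
    obtain c where c: "norm c \<le> real n" "z + c *s (u /\<^sub>R norm u) \<notin> closure \<Omega>"
      using n[of "u /\<^sub>R norm u"] u0 by auto
    have "c *s (u /\<^sub>R norm u) = (c / of_real (norm u)) *s u"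
      by (simp add: scaleR_eq_vector_smult vector_smult_assoc divide_inverse)
    moreover have "norm (c / of_real (norm u)) \<le> 1"
      using c(1) un u0 by (simp add: norm_divide)
    ultimately show False using c(2) u by (auto simp: B_def)
  qed
  have convex_B: "convex B"
  proof (rule convexI)
    fix x y and a b :: real
    assume xy: "x \<in> B" "y \<in> B" and ab: "0 \<le> a" "0 \<le> b" "a + b = 1"
    show "a *\<^sub>R x + b *\<^sub>R y \<in> B"
      unfolding B_def
    proof clarify
      fix c :: complex assume "norm c \<le> 1"
      then have "a *\<^sub>R (z + c *s x) + b *\<^sub>R (z + c *s y) \<in> closure \<Omega>"
        using xy ab by (intro convexD[OF convex_closure[OF cv]]) (auto simp: B_def)
      also have "a *\<^sub>R (z + c *s x) + b *\<^sub>R (z + c *s y) = (a + b) *\<^sub>R z + c *s (a *\<^sub>R x + b *\<^sub>R y)"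
        by (simp add: vec_eq_iff scaleR_conv_of_real[of _ "_ :: complex"] algebra_simps)
      finally show "z + c *s (a *\<^sub>R x + b *\<^sub>R y) \<in> closure \<Omega>" using ab by simp
    qed
  qed
  have balanced_B: "t *s u \<in> B" if "u \<in> B" "norm t \<le> 1" for t u
    unfolding B_def
  proof clarify
    fix c :: complex assume "norm c \<le> 1"
    then have "norm (c * t) \<le> 1" using that mult_le_one[of "norm c" "norm t"] by (simp add: norm_mult)
    then show "z + c *s (t *s u) \<in> closure \<Omega>"
      using that by (simp add: vector_smult_assoc B_def)
  qed
  obtain e where e: "0 < e" "ball z e \<subseteq> \<Omega>" using op z by (meson open_contains_ball)
  have small_B: "u \<in> B" if "norm u < e" for u
    unfolding B_def
  proof clarify
    fix c :: complex assume "norm c \<le> 1"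
    then have "norm (c *s u) < e"
      using that mult_right_mono[of "norm c" 1 "norm u"] by (simp add: norm_vector_smult)
    then have "z + c *s u \<in> ball z e" by (simp add: dist_norm)
    then show "z + c *s u \<in> closure \<Omega>" using e closure_subset by blast
  qed
  define S where "S = {U :: complex ^ 'd ^ 'd. \<forall>j. U $ j \<in> B}"
  have "compact S"
    unfolding compact_eq_bounded_closed
  proof
    have "norm U \<le> (\<Sum>j\<in>(UNIV::'d set). real n)" if "U \<in> S" for U
    proof -
      have "norm U \<le> (\<Sum>j\<in>UNIV. norm (U $ j))" by (rule vec_norm_le_sum)
      also have "\<dots> \<le> (\<Sum>j\<in>(UNIV::'d set). real n)"
        using that norm_B by (intro sum_mono) (auto simp: S_def)
      finally show ?thesis .
    qed
    then show "bounded S" unfolding bounded_iff by blast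
    have "S = (\<Inter>j. (\<lambda>U. U $ j) -` B)" by (auto simp: S_def)
    moreover have "closed ((\<lambda>U :: complex ^ 'd ^ 'd. U $ j) -` B)" for j
      by (intro closed_vimage closed_B continuous_intros)
    ultimately show "closed S" by auto
  qed
  define E :: "complex ^ 'd ^ 'd" where "E = (\<chi> i j. if i = j then of_real (e / 2) else 0)"
  have "E \<in> S"
  proof -
    have "E $ i = of_real (e / 2) *s axis i 1" for i
      by (auto simp: E_def vec_eq_iff axis_def)
    then have "norm (E $ i) < e" for i
      using e by (simp add: norm_vector_smult)
    then show ?thesis using small_B by (auto simp: S_def)
  qed
  have "det E = (\<Prod>i\<in>(UNIV::'d set). of_real (e / 2))"
    by (subst det_diagonal) (auto simp: E_def)
  then have det_E: "det E \<noteq> 0" using e by simp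
  obtain U where U: "U \<in> S" and max: "\<And>V. V \<in> S \<Longrightarrow> norm (det V) \<le> norm (det U)"
    using continuous_attains_sup[OF \<open>compact S\<close>, of "\<lambda>V. norm (det V)"] \<open>E \<in> S\<close>
      continuous_on_norm[OF continuous_on_det] by auto
  have det_U: "det U \<noteq> 0" using max[OF \<open>E \<in> S\<close>] det_E by auto
  define Q where "Q = transpose U"
  have "invertible Q" using det_U by (simp add: invertible_det_nz Q_def det_transpose)
  then obtain A where inv: "Q ** A = mat 1" "A ** Q = mat 1"
    unfolding invertible_def by blast
  then have QA: "Q *v (A *v x) = x" and AQ: "A *v (Q *v x) = x" for x
    by (simp_all add: matrix_vector_mul_assoc)
  have inv_A: "invertible A"
    using inv unfolding invertible_def by blast
  have Q_sum: "Q *v x = (\<Sum>i\<in>UNIV. x $ i *s U $ i)" for x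
    by (simp add: matrix_mult_sum Q_def row_def)
  have coord: "norm (x $ k) \<le> 1" if "Q *v x \<in> B" for x :: "complex ^ 'd" and k
  proof -
    let ?V = "\<chi> i. if i = k then sum (\<lambda>i. x $ i *s row i U) UNIV else row i U"
    have "?V \<in> S"
      using that U by (auto simp: S_def Q_sum row_def)
    then have "norm (x $ k * det U) \<le> norm (det U)"
      using max[of ?V] by (simp only: cramer_lemma_transpose)
    then show ?thesis using det_U by (simp add: norm_mult)
  qed
  show ?thesis
  proof (rule that[OF inv_A])
    show "ball 0 (1 / (2 * real CARD('d))) \<subseteq> (\<lambda>x. A *v (x - z)) ` \<Omega>"
    proof
      fix x :: "complex ^ 'd" assume x: "x \<in> ball 0 (1 / (2 * real CARD('d)))"
      have d: "0 < real CARD('d)" by simp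
      have xk: "norm (x $ k) < 1 / (2 * real CARD('d))" for k
        using x Finite_Cartesian_Product.norm_nth_le[of x k] by simp
      define y where "y = (\<Sum>i\<in>UNIV. (1 / real CARD('d)) *\<^sub>R ((2 * of_nat CARD('d) * x $ i) *s U $ i))"
      have "y \<in> B"
        unfolding y_def
      proof (rule convex_sum[OF _ convex_B])
        show "(2 * of_nat CARD('d) * x $ i) *s U $ i \<in> B" for i
        proof (rule balanced_B)
          show "U $ i \<in> B" using U by (auto simp: S_def)
          show "norm (2 * of_nat CARD('d) * x $ i) \<le> 1"
            using xk[of i] d by (simp add: norm_mult field_simps)
        qed
      qed auto
      moreover have y: "y = 2 *\<^sub>R (Q *v x)"
        unfolding y_def Q_sum scaleR_right.sum
        by (intro sum.cong refl) (auto simp: vec_eq_iff scaleR_conv_of_real[of _ "_ :: complex"])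
      ultimately have "z + 1 *s (2 *\<^sub>R (Q *v x)) \<in> closure \<Omega>"
        unfolding B_def by (metis (mono_tags) mem_Collect_eq norm_one order_refl)
      then have "(z + 1 *s (2 *\<^sub>R (Q *v x))) + (1/2) *\<^sub>R (z - (z + 1 *s (2 *\<^sub>R (Q *v x)))) \<in> \<Omega>"
        using op cv z by (intro open_convex_closure_combination) auto
      also have "(z + 1 *s (2 *\<^sub>R (Q *v x))) + (1/2) *\<^sub>R (z - (z + 1 *s (2 *\<^sub>R (Q *v x)))) = z + Q *v x"
        by (simp add: vec_eq_iff scaleR_conv_of_real[of _ "_ :: complex"])
      finally have "z + Q *v x \<in> \<Omega>" .
      then show "x \<in> (\<lambda>x. A *v (x - z)) ` \<Omega>"
        by (intro image_eqI[of _ _ "z + Q *v x"]) (simp_all add: AQ)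
    qed
    fix u :: "complex ^ 'd" assume u: "\<And>c. norm c \<le> 1 \<Longrightarrow> c *s u \<in> (\<lambda>x. A *v (x - z)) ` \<Omega>"
    have "Q *v u \<in> B"
      unfolding B_def
    proof clarify
      fix c :: complex assume "norm c \<le> 1"
      then obtain x where x: "x \<in> \<Omega>" "c *s u = A *v (x - z)" using u by blast
      have "c *s (Q *v u) = Q *v (c *s u)" by (simp add: vector_scalar_commute)
      also have "\<dots> = x - z" by (simp add: x QA)
      finally show "z + c *s (Q *v u) \<in> closure \<Omega>" using x closure_subset by auto
    qed
    then have "norm (u $ k) \<le> 1" for k by (rule coord)
    then have "(\<Sum>k\<in>UNIV. norm (u $ k)) \<le> (\<Sum>k\<in>(UNIV::'d set). 1)" by (intro sum_mono) auto
    then show "norm u \<le> real CARD('d)" using vec_norm_le_sum[of u] by simp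
  qed
qed

lemma normalized_gauge:
  fixes \<Omega> :: "(complex ^ 'd::finite) set"
  assumes \<Omega>: "\<Omega> \<in> C_properly_convex_domains" and z: "z \<in> \<Omega>"
  obtains A :: "complex ^ 'd ^ 'd" and p where "invertible A" "bounded_gauge p (1 / (2 * real CARD('d)))"
    "{x. p x < 1} = (\<lambda>x. A *v (x - z)) ` \<Omega>"
    "\<And>u s. 0 < s \<Longrightarrow> (\<And>c. norm c \<le> 1 \<Longrightarrow> p (c *s u) < s) \<Longrightarrow> norm u \<le> real CARD('d) * s"
proof -
  obtain A :: "complex ^ 'd ^ 'd" where A: "invertible A"
    "ball 0 (1 / (2 * real CARD('d))) \<subseteq> (\<lambda>x. A *v (x - z)) ` \<Omega>"
    "\<And>u. (\<And>c. norm c \<le> 1 \<Longrightarrow> c *s u \<in> (\<lambda>x. A *v (x - z)) ` \<Omega>) \<Longrightarrow> norm u \<le> real CARD('d)"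
    using affine_normalization[OF \<Omega> z] by blast
  let ?T = "\<lambda>x. A *v (x - z)"
  obtain A' where A': "A ** A' = mat 1" "A' ** A = mat 1"
    using A(1) unfolding invertible_def by blast
  have "?T ` \<Omega> = (\<lambda>y. z + A' *v y) -` \<Omega>"
  proof
    show "?T ` \<Omega> \<subseteq> (\<lambda>y. z + A' *v y) -` \<Omega>" using A'(2) by (auto simp: matrix_vector_mul_assoc)
    show "(\<lambda>y. z + A' *v y) -` \<Omega> \<subseteq> ?T ` \<Omega>"
    proof
      fix y assume "y \<in> (\<lambda>y. z + A' *v y) -` \<Omega>"
      then show "y \<in> ?T ` \<Omega>" using A'(1)
        by (intro image_eqI[of _ _ "z + A' *v y"]) (auto simp: matrix_vector_mul_assoc)
    qed
  qed
  moreover have "continuous_on UNIV (\<lambda>y. z + A' *v y)"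
    by (intro continuous_on_add continuous_on_const linear_continuous_on
        linear_conv_bounded_linear[THEN iffD1] matrix_vector_mul_linear)
  ultimately have op: "open (?T ` \<Omega>)"
    using open_vimage[OF open_properly_convex[OF \<Omega>]] by metis
  have "?T ` \<Omega> = (*v) A ` (\<lambda>x. - z + x) ` \<Omega>" by (simp add: image_image)
  then have cv: "convex (?T ` \<Omega>)"
    by (simp add: convex_linear_image convex_translation convex_properly_convex[OF \<Omega>])
  interpret gauged_set "?T ` \<Omega>" "1 / (2 * real CARD('d))"
    using op cv A(2) by unfold_locales auto
  let ?p = "minkowski_gauge (?T ` \<Omega>)"
  interpret p: bounded_gauge ?p "1 / (2 * real CARD('d))" by (rule bounded_gauge)
  show ?thesis
  proof (rule that[OF A(1) bounded_gauge])
    show "{x. ?p x < 1} = ?T ` \<Omega>" using gauge_less_1_iff by auto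
    fix u and s :: real assume s: "0 < s" and u: "\<And>c. norm c \<le> 1 \<Longrightarrow> ?p (c *s u) < s"
    have "norm (u /\<^sub>R s) \<le> real CARD('d)"
    proof (rule A(3))
      fix c :: complex assume "norm c \<le> 1"
      then have "?p (c *s u) < s" by (rule u)
      moreover have "c *s (u /\<^sub>R s) = (c *s u) /\<^sub>R s"
        by (simp add: vec_eq_iff)
      ultimately have "?p (c *s (u /\<^sub>R s)) < 1"
        using s p.scale[of "inverse s" "c *s u"] by (simp add: divide_inverse_commute[symmetric])
      then show "c *s (u /\<^sub>R s) \<in> ?T ` \<Omega>" by (simp add: gauge_less_1_iff)
    qed
    then show "norm u \<le> real CARD('d) * s" using s by (simp add: field_simps)
  qed
qed

section \<open>Doubling of discs\<close>

lemma affine_disc: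
  "A *v (a + c *s u - z) = A *v (a - z) + c *s (A *v (u :: complex ^ 'd::finite))"
  by (simp add: algebra_simps vector_scalar_commute)

lemma disc_doubling_counterexample:
  fixes \<Omega> :: "(complex ^ 'd::finite) set"
  assumes \<Omega>: "\<Omega> \<in> C_properly_convex_domains" and z: "z \<in> \<Omega>" and \<xi>: "\<xi> \<in> frontier \<Omega>"
    and cone: "\<And>c. norm c < c0 \<Longrightarrow> z + c *s (\<xi> - z) \<in> \<Omega>"
    and disc: "\<And>c. norm c < 1 \<Longrightarrow> \<xi> + e *\<^sub>R (z - \<xi>) + c *s u \<in> \<Omega>"
    and c1: "norm c1 < 1" and large: "z + (2 * c1) *s u \<notin> \<Omega>"
    and c0: "0 < c0" and e: "0 \<le> e" "e \<le> 1"
  shows "\<exists>T p \<zeta> w. T \<in> affine_automorphisms \<and> {x. p x < 1} = T ` \<Omega> \<and>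
    bounded_gauge p (1 / (2 * real CARD('d))) \<and>
    (\<forall>u s. 0 < s \<longrightarrow> (\<forall>c. norm c \<le> 1 \<longrightarrow> p (c *s u) < s) \<longrightarrow> norm u \<le> real CARD('d) * s) \<and>
    p \<zeta> = 1 \<and> norm \<zeta> \<le> 2 * real CARD('d) / c0 \<and>
    (\<forall>c. norm c < 1 \<longrightarrow> p (\<zeta> - e *\<^sub>R \<zeta> + c *s w) < 1) \<and>
    1 \<le> 4 * real CARD('d) * norm w \<and>
    norm w \<le> 2 * real CARD('d) * (1 + 4 * real CARD('d) * real CARD('d) / c0)"
proof -
  obtain A :: "complex ^ 'd ^ 'd" and p where inv: "invertible A" and p: "bounded_gauge p (1 / (2 * real CARD('d)))"
    and sub: "{x. p x < 1} = (\<lambda>x. A *v (x - z)) ` \<Omega>"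
    and ker: "\<And>u s. 0 < s \<Longrightarrow> (\<And>c. norm c \<le> 1 \<Longrightarrow> p (c *s u) < s) \<Longrightarrow> norm u \<le> real CARD('d) * s"
    by (rule normalized_gauge[OF \<Omega> z]) blast
  interpret p: bounded_gauge p "1 / (2 * real CARD('d))" by (rule p)
  let ?T = "\<lambda>x. A *v (x - z)"
  obtain A' where A': "A' ** A = mat 1"
    using inv unfolding invertible_def by blast
  have inj: "A *v x = A *v y \<Longrightarrow> x = y" for x y
    using A' by (metis matrix_vector_mul_assoc matrix_vector_mul_lid)
  have mem: "p (?T x) < 1 \<longleftrightarrow> x \<in> \<Omega>" for x
  proof -
    have "p (?T x) < 1 \<longleftrightarrow> ?T x \<in> ?T ` \<Omega>" unfolding sub[symmetric] by simp
    then show ?thesis by (auto dest: inj)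
  qed
  define d where "d = real CARD('d)"
  have d: "1 \<le> d" unfolding d_def by (simp add: Suc_leI)
  have bound: "p x \<le> 2 * d * norm x" for x using p.bound[of x] by (simp add: d_def mult_ac)
  define \<zeta> where "\<zeta> = ?T \<xi>"
  define w where "w = A *v u"
  have aff: "?T \<in> affine_automorphisms"
    unfolding affine_automorphisms_def
  proof (intro CollectI exI conjI)
    show "?T = (\<lambda>x. A *v x + (- (A *v z)))" by (simp add: algebra_simps)
  qed (rule inv)
  have "\<xi> \<notin> \<Omega>" using \<xi> open_properly_convex[OF \<Omega>] by (simp add: frontier_def interior_open)
  then have "p \<zeta> \<ge> 1" using mem[of \<xi>] by (simp add: \<zeta>_def)
  moreover have "p \<zeta> \<le> 1"
  proof -
    have "\<xi> \<in> closure \<Omega>" using \<xi> by (simp add: frontier_def)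
    moreover have "continuous_on (closure \<Omega>) ?T"
      unfolding matrix_vector_mult_diff_distrib
      by (intro continuous_on_diff continuous_on_const linear_continuous_on
        linear_conv_bounded_linear[THEN iffD1] matrix_vector_mul_linear)
    moreover have "?T ` \<Omega> \<subseteq> closure {x. p x < 1}" unfolding sub by (rule closure_subset)
    ultimately have "?T \<xi> \<in> closure {x. p x < 1}"
      using image_closure_subset[of \<Omega> ?T "closure {x. p x < 1}"] by blast
    then show ?thesis by (simp add: p.closure_sublevel \<zeta>_def)
  qed
  ultimately have p\<zeta>: "p \<zeta> = 1" by simp
  have cone': "p (c *s \<zeta>) < 1" if "norm c < c0" for c
    using mem[of "z + c *s (\<xi> - z)"] cone[OF that] affine_disc[of A z c "\<xi> - z" z]
    by (simp add: \<zeta>_def)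
  have n\<zeta>: "norm \<zeta> \<le> 2 * d / c0"
  proof -
    have "norm ((c0 / 2) *\<^sub>R \<zeta>) \<le> d * 1"
      unfolding d_def
    proof (rule ker)
      fix c :: complex assume "norm c \<le> 1"
      then have "norm (c * of_real (c0 / 2)) \<le> c0 / 2"
        using c0 mult_right_mono[of "norm c" 1 "c0 / 2"] by (simp add: norm_mult)
      then have "norm (c * of_real (c0 / 2)) < c0" using c0 by linarith
      then show "p (c *s (c0 / 2) *\<^sub>R \<zeta>) < 1"
        using cone' by (simp add: scaleR_eq_vector_smult vector_smult_assoc)
    qed simp
    then show ?thesis using c0 by (simp add: field_simps)
  qed
  have disc': "p (\<zeta> - e *\<^sub>R \<zeta> + c *s w) < 1" if "norm c < 1" for c
  proof -
    have "?T (\<xi> + e *\<^sub>R (z - \<xi>) + c *s u) = A *v (\<xi> + of_real e *s (z - \<xi>) - z) + c *s (A *v u)"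
      by (simp only: affine_disc scaleR_eq_vector_smult)
    also have "\<dots> = \<zeta> - e *\<^sub>R \<zeta> + c *s w"
      by (simp add: affine_disc scaleR_eq_vector_smult \<zeta>_def w_def matrix_vector_mult_diff_distrib vector_ssub_ldistrib matrix_vector_right_distrib vector_scalar_commute)
    finally show ?thesis using disc[OF that] mem by metis
  qed
  have "1 \<le> p ((2 * c1) *s w)"
  proof -
    have "?T (z + (2 * c1) *s u) = (2 * c1) *s w"
      using affine_disc[of A z "2 * c1" u z] by (simp add: w_def)
    then show ?thesis using large mem by (metis not_le)
  qed
  also have "\<dots> \<le> 2 * d * (norm (2 * c1) * norm w)"
    using bound[of "(2 * c1) *s w"] by (simp add: norm_vector_smult)
  also have "\<dots> \<le> 2 * d * (2 * norm w)"
    using c1 d by (intro mult_left_mono mult_right_mono) (auto simp: norm_mult)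
  finally have w1: "1 \<le> 4 * d * norm w" by simp
  have "norm ((1/2) *\<^sub>R w) \<le> d * (1 + 4 * d * d / c0)"
    unfolding d_def
  proof (rule ker; fold d_def)
    show "0 < 1 + 4 * d * d / c0" using d c0 by (intro add_pos_nonneg) auto
    fix c :: complex assume "norm c \<le> 1"
    then have "norm (c * (1/2)) < 1" by (simp add: norm_mult)
    then have *: "p (\<zeta> - e *\<^sub>R \<zeta> + (c * (1/2)) *s w) < 1" by (rule disc')
    have eq: "c *s (1/2) *\<^sub>R w = (\<zeta> - e *\<^sub>R \<zeta> + (c * (1/2)) *s w) + (- ((1 - e) *\<^sub>R \<zeta>))"
      by (simp add: algebra_simps scaleR_eq_vector_smult vector_smult_assoc)
    have "p (c *s (1/2) *\<^sub>R w) \<le> p (\<zeta> - e *\<^sub>R \<zeta> + (c * (1/2)) *s w) + p (- ((1 - e) *\<^sub>R \<zeta>))"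
      unfolding eq by (rule p.subadd)
    also have "p (- ((1 - e) *\<^sub>R \<zeta>)) \<le> 2 * d * ((1 - e) * norm \<zeta>)"
      using bound[of "- ((1 - e) *\<^sub>R \<zeta>)"] e by simp
    also have "\<dots> \<le> 2 * d * (1 * (2 * d / c0))"
      using e d n\<zeta> by (intro mult_left_mono mult_mono) auto
    finally show "p (c *s (1/2) *\<^sub>R w) < 1 + 4 * d * d / c0" using * by simp
  qed
  then have w2: "norm w \<le> 2 * d * (1 + 4 * d * d / c0)" by (simp add: mult_ac)
  show ?thesis
    unfolding d_def[symmetric]
    using aff sub p[folded d_def] ker[folded d_def] p\<zeta> n\<zeta> disc' w1 w2 by blast
qed

lemma bounded_gauge_tendsto:
  assumes p: "\<And>n. bounded_gauge (p n) r" and lim: "(\<lambda>n. p n x) \<longlonglongrightarrow> L" and x: "X \<longlonglongrightarrow> x"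
  shows "(\<lambda>n. p n (X n)) \<longlonglongrightarrow> L"
proof -
  have "(\<lambda>n. p n (X n) - p n x) \<longlonglongrightarrow> 0"
  proof (rule Lim_null_comparison)
    show "\<forall>\<^sub>F n in sequentially. norm (p n (X n) - p n x) \<le> norm (X n - x) / r"
      using bounded_gauge.diff_le[OF p] by (auto intro!: always_eventually)
    have "(\<lambda>n. norm (X n - x)) \<longlonglongrightarrow> 0" using x by (simp add: LIM_zero tendsto_norm_zero)
    then show "(\<lambda>n. norm (X n - x) / r) \<longlonglongrightarrow> 0" by (rule tendsto_divide_zero)
  qed
  from tendsto_add[OF this lim] show ?thesis by simp
qed

lemma disc_doubling:
  fixes K :: "(complex ^ 'd::finite) set set"
  assumes K: "K \<subseteq> C_properly_convex_domains"
    and simple: "\<And>D. D \<in> affine_orbit_closure K \<Longrightarrow> simple_boundary D"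
    and c0: "0 < c0"
  shows "\<exists>M\<ge>2. \<forall>\<Omega>\<in>K. \<forall>z\<in>\<Omega>. \<forall>\<xi>\<in>frontier \<Omega>. \<forall>u.
    (\<forall>c. norm c < c0 \<longrightarrow> z + c *s (\<xi> - z) \<in> \<Omega>) \<longrightarrow>
    (\<forall>c. norm c < 1 \<longrightarrow> \<xi> + (1 / M) *\<^sub>R (z - \<xi>) + c *s u \<in> \<Omega>) \<longrightarrow>
    (\<forall>c. norm c < 1 \<longrightarrow> z + (2 * c) *s u \<in> \<Omega>)"
proof (rule ccontr)
  define d where "d = real CARD('d)"
  define B where "B = 2 * d / c0"
  define W where "W = 2 * d * (1 + 4 * d * d / c0)"
  define r where "r = 1 / (2 * d)"
  have d: "1 \<le> d" unfolding d_def by (simp add: Suc_leI)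
  assume neg: "\<not> ?thesis"
  have "\<exists>T p \<zeta> w \<Omega>. \<Omega> \<in> K \<and> T \<in> affine_automorphisms \<and> {x. p x < 1} = T ` \<Omega> \<and>
    bounded_gauge p r \<and>
    (\<forall>u s. 0 < s \<longrightarrow> (\<forall>c. norm c \<le> 1 \<longrightarrow> p (c *s u) < s) \<longrightarrow> norm u \<le> d * s) \<and>
    p \<zeta> = 1 \<and> norm \<zeta> \<le> B \<and>
    (\<forall>c. norm c < 1 \<longrightarrow> p (\<zeta> - (1 / real (n + 2)) *\<^sub>R \<zeta> + c *s w) < 1) \<and>
    1 \<le> 4 * d * norm w \<and> norm w \<le> W" for n
  proof -
    have "2 \<le> real (n + 2)" by simp
    with neg obtain \<Omega> z \<xi> u c1 where *: "\<Omega> \<in> K" "z \<in> \<Omega>" "\<xi> \<in> frontier \<Omega>"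
      "\<And>c. norm c < c0 \<Longrightarrow> z + c *s (\<xi> - z) \<in> \<Omega>"
      "\<And>c. norm c < 1 \<Longrightarrow> \<xi> + (1 / real (n + 2)) *\<^sub>R (z - \<xi>) + c *s u \<in> \<Omega>"
      "norm c1 < 1" "z + (2 * c1) *s u \<notin> \<Omega>"
      by blast
    have "\<Omega> \<in> C_properly_convex_domains" using * K by blast
    from disc_doubling_counterexample[OF this *(2-7) c0] *(1) show ?thesis
      unfolding d_def[symmetric] r_def B_def W_def by (simp add: divide_le_eq) blast
  qed
  then obtain T p \<zeta> w \<Omega> where \<Omega>: "\<And>n. \<Omega> n \<in> K" and T: "\<And>n::nat. T n \<in> affine_automorphisms"
    and sub: "\<And>n. {x. p n x < 1} = T n ` \<Omega> n" and p: "\<And>n. bounded_gauge (p n) r"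
    and ker: "\<And>n u s. 0 < s \<Longrightarrow> (\<And>c. norm c \<le> 1 \<Longrightarrow> p n (c *s u) < s) \<Longrightarrow> norm u \<le> d * s"
    and p\<zeta>: "\<And>n. p n (\<zeta> n) = 1" and \<zeta>B: "\<And>n. norm (\<zeta> n) \<le> B"
    and disc: "\<And>n c. norm c < 1 \<Longrightarrow> p n (\<zeta> n - (1 / real (n + 2)) *\<^sub>R \<zeta> n + c *s w n) < 1"
    and w: "\<And>n. 1 \<le> 4 * d * norm (w n)" and wW: "\<And>n. norm (w n) \<le> W"
    by metis
  have "compact (cball (0 :: complex ^ 'd) B \<times> cball (0 :: complex ^ 'd) W)"
    by (intro compact_Times compact_cball)
  moreover have "\<forall>n. (\<zeta> n, w n) \<in> cball 0 B \<times> cball 0 W" using \<zeta>B wW by simp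
  ultimately obtain l k where k: "strict_mono (k :: nat \<Rightarrow> nat)" and lim: "((\<lambda>n. (\<zeta> n, w n)) \<circ> k) \<longlonglongrightarrow> l"
    unfolding compact_def by meson
  define \<zeta>' w' where "\<zeta>' = fst l" and "w' = snd l"
  have lim1: "(\<lambda>n. \<zeta> (k n)) \<longlonglongrightarrow> \<zeta>'" and lim2: "(\<lambda>n. w (k n)) \<longlonglongrightarrow> w'"
    using tendsto_fst[OF lim] tendsto_snd[OF lim] by (simp_all add: \<zeta>'_def w'_def o_def)
  obtain q j where q: "bounded_gauge q r" and j: "strict_mono (j :: nat \<Rightarrow> nat)"
    and ptw: "\<And>x. (\<lambda>n. p (k (j n)) x) \<longlonglongrightarrow> q x"
    and unif: "\<And>e. 0 < e \<Longrightarrow> \<exists>N. \<forall>n\<ge>N. \<forall>x. \<bar>p (k (j n)) x - q x\<bar> \<le> e * norm x"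
    by (rule bounded_gauge_subsequence[of "\<lambda>n. p (k n)" r]) (use p in auto)
  define h where "h = k \<circ> j"
  have h: "strict_mono h" using k j by (simp add: h_def strict_mono_o)
  note ptw = ptw[folded o_apply[of k j], folded h_def] and unif = unif[folded o_apply[of k j], folded h_def]
  have lim1: "(\<lambda>n. \<zeta> (h n)) \<longlonglongrightarrow> \<zeta>'" and lim2: "(\<lambda>n. w (h n)) \<longlonglongrightarrow> w'"
    using LIMSEQ_subseq_LIMSEQ[OF lim1 j] LIMSEQ_subseq_LIMSEQ[OF lim2 j] by (simp_all add: h_def o_def)
  interpret q: bounded_gauge q r by (rule q)
  define D where "D = {x. q x < 1}"
  have "D \<in> C_properly_convex_domains"
    unfolding C_properly_convex_domains_def
  proof (intro CollectI conjI allI impI notI)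
    show "open D" "convex D" unfolding D_def by (rule q.open_sublevel q.convex_sublevel)+
    show "D = {} \<Longrightarrow> False" using q.zero unfolding D_def by (metis empty_iff mem_Collect_eq zero_less_one)
    fix z v :: "complex ^ 'd" assume v: "v \<noteq> 0" and line: "complex_line z v \<subseteq> D"
    have line: "q (z + c *s v) < 1" for c using line by (auto simp: complex_line_def D_def)
    have zero: "q (c *s v) = 0" for c
    proof (rule ccontr)
      assume "q (c *s v) \<noteq> 0"
      then have pos: "0 < q (c *s v)" using q.nonneg[of "c *s v"] by simp
      have le: "t * q (c *s v) \<le> 1 + q (- z)" if "0 \<le> t" for t
      proof -
        have "t * q (c *s v) = q ((z + (of_real t * c) *s v) + (- z))"
          using q.scale[OF that, of "c *s v"] by (simp add: scaleR_eq_vector_smult vector_smult_assoc)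
        also have "\<dots> \<le> q (z + (of_real t * c) *s v) + q (- z)" by (rule q.subadd)
        also have "\<dots> \<le> 1 + q (- z)" using line[of "of_real t * c"] by simp
        finally show ?thesis .
      qed
      show False
        using le[of "(2 + q (- z)) / q (c *s v)"] pos q.nonneg[of "- z"] by simp
    qed
    obtain N where N: "\<And>n x. n \<ge> N \<Longrightarrow> \<bar>p (h n) x - q x\<bar> \<le> 1 / (4 * d) * norm x"
      using unif[of "1 / (4 * d)"] d by auto
    have "norm v \<le> d * (1 / (2 * d) * norm v)"
    proof (rule ker[of _ "h N"])
      show "0 < 1 / (2 * d) * norm v" using v d by simp
      fix c :: complex assume c: "norm c \<le> 1"
      have "p (h N) (c *s v) \<le> 1 / (4 * d) * norm (c *s v)"
        using N[OF order_refl, of "c *s v"] zero[of c] by linarith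
      also have "\<dots> \<le> 1 / (4 * d) * norm v"
        using c d mult_right_mono[of "norm c" 1 "norm v"] by (intro mult_left_mono) (auto simp: norm_vector_smult)
      also have "\<dots> < 1 / (2 * d) * norm v"
        using v d by (intro mult_strict_right_mono) (auto simp: field_simps)
      finally show "p (h N) (c *s v) < 1 / (2 * d) * norm v" .
    qed
    then show False using v d by simp
  qed
  moreover have "local_hausdorff_converges (\<lambda>n. T (h n) ` \<Omega> (h n)) D"
    unfolding D_def sub[symmetric] by (rule local_hausdorff_converges_sublevel[OF p q unif])
  ultimately have "D \<in> affine_orbit_closure K"
    unfolding affine_orbit_closure_def using T \<Omega>
    by (intro CollectI conjI exI[of _ "\<lambda>n. T (h n)"] exI[of _ "\<lambda>n. \<Omega> (h n)"]) auto
  then have "simple_boundary D" by (rule simple)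
  have q\<zeta>: "q \<zeta>' = 1"
    using LIMSEQ_unique[OF bounded_gauge_tendsto[of "\<lambda>n. p (h n)", OF p ptw lim1]] p\<zeta> by simp
  have le: "q (\<zeta>' + c *s w') \<le> 1" if "norm c < 1" for c
  proof (rule LIMSEQ_le_const2)
    have "(\<lambda>n. 1 / real (h n + 2)) \<longlonglongrightarrow> 0"
      using LIMSEQ_subseq_LIMSEQ[OF _ h, of "\<lambda>n. 1 / real (n + 2)" 0] LIMSEQ_ignore_initial_segment[OF lim_1_over_n, of 2] by (simp add: o_def)
    then have "(\<lambda>n. \<zeta> (h n) - (1 / real (h n + 2)) *\<^sub>R \<zeta> (h n) + c *s w (h n)) \<longlonglongrightarrow> \<zeta>' - 0 *\<^sub>R \<zeta>' + c *s w'"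
      by (intro tendsto_intros tendsto_vector_smult lim1 lim2)
    then show "(\<lambda>n. p (h n) (\<zeta> (h n) - (1 / real (h n + 2)) *\<^sub>R \<zeta> (h n) + c *s w (h n))) \<longlonglongrightarrow> q (\<zeta>' + c *s w')"
      by (intro bounded_gauge_tendsto[of "\<lambda>n. p (h n)", OF p ptw]) simp
    show "\<exists>N. \<forall>n\<ge>N. p (h n) (\<zeta> (h n) - (1 / real (h n + 2)) *\<^sub>R \<zeta> (h n) + c *s w (h n)) \<le> 1"
      using disc[OF that] by (auto intro: less_imp_le)
  qed
  have eq: "q (\<zeta>' + c *s w') = 1" if c: "norm c < 1" for c
  proof -
    have "2 *\<^sub>R \<zeta>' = (\<zeta>' + c *s w') + (\<zeta>' + (- c) *s w')"
      by (simp add: scaleR_2 vector_smult_lneg)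
    then have "2 \<le> q (\<zeta>' + c *s w') + q (\<zeta>' + (- c) *s w')"
      using q.subadd[of "\<zeta>' + c *s w'" "\<zeta>' + (- c) *s w'"] q.scale[of 2 \<zeta>'] q\<zeta> by simp
    then show ?thesis using le[of c] le[of "- c"] c by simp
  qed
  define f where "f t = \<zeta>' + t *s w'" for t
  have "f constant_on ball 0 1"
  proof -
    have "(\<lambda>t. f t $ i) holomorphic_on ball 0 1" for i
      unfolding f_def vector_add_component vector_smult_component by (intro holomorphic_intros)
    moreover have "f ` ball 0 1 \<subseteq> frontier D"
      using eq unfolding D_def q.frontier_sublevel f_def by auto
    ultimately show ?thesis
      using \<open>simple_boundary D\<close> unfolding simple_boundary_def by blast
  qed
  then have "f 0 = f (1/2)" unfolding constant_on_def by (auto simp: norm_divide)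
  then have "w' = 0" by (simp add: f_def)
  moreover have "1 \<le> 4 * d * norm w'"
    by (rule LIMSEQ_le_const[of "\<lambda>n. 4 * d * norm (w (h n))"]) (use w lim2 in \<open>auto intro!: tendsto_intros\<close>)
  ultimately show False by simp
qed

section \<open>Uniformity over compact families\<close>

lemma eventually_cball_subset:
  fixes \<Omega> :: "(complex ^ 'd::finite) set"
  assumes conv: "local_hausdorff_converges \<Omega>s \<Omega>" and dom: "range \<Omega>s \<subseteq> C_properly_convex_domains"
    and op: "open \<Omega>" and sub: "cball p \<rho> \<subseteq> \<Omega>"
  shows "\<forall>\<^sub>F n in sequentially. cball p \<rho> \<subseteq> \<Omega>s n"
proof -
  obtain e where e: "0 < e" and nbhd: "(\<Union>x\<in>cball p \<rho>. ball x e) \<subseteq> \<Omega>"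
    using compact_subset_open_imp_ball_epsilon_subset[OF compact_cball op sub] by blast
  obtain R0 where R0: "0 \<le> R0" "\<And>R. R \<ge> R0 \<Longrightarrow>
      (\<lambda>n. hausdorff_distance (closure (\<Omega>s n) \<inter> cball 0 R) (closure \<Omega> \<inter> cball 0 R)) \<longlonglongrightarrow> 0"
    using conv unfolding local_hausdorff_converges_def by blast
  define R where "R = R0 + norm p + \<bar>\<rho>\<bar> + e"
  have "(\<lambda>n. hausdorff_distance (closure (\<Omega>s n) \<inter> cball 0 R) (closure \<Omega> \<inter> cball 0 R)) \<longlonglongrightarrow> 0"
    using e by (intro R0(2)) (simp add: R_def)
  then have "\<forall>\<^sub>F n in sequentially.
      hausdorff_distance (closure (\<Omega>s n) \<inter> cball 0 R) (closure \<Omega> \<inter> cball 0 R) < ennreal (e / 2)"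
    by (rule order_tendstoD) (use e in simp)
  then show ?thesis
  proof (rule eventually_mono)
    fix n
    assume hd: "hausdorff_distance (closure (\<Omega>s n) \<inter> cball 0 R) (closure \<Omega> \<inter> cball 0 R) < ennreal (e / 2)"
    have n: "convex (\<Omega>s n)" "\<Omega>s n \<noteq> {}"
      using dom by (auto simp: C_properly_convex_domains_def)
    show "cball p \<rho> \<subseteq> \<Omega>s n"
    proof (rule ccontr)
      assume "\<not> cball p \<rho> \<subseteq> \<Omega>s n"
      then obtain y where y: "y \<in> cball p \<rho>" "y \<notin> \<Omega>s n" by blast
      then obtain a b where a: "a \<noteq> 0" and ab: "\<And>x. x \<in> \<Omega>s n \<Longrightarrow> a \<bullet> x \<le> b" "b \<le> a \<bullet> y"
        using separating_hyperplane_sets[of "\<Omega>s n" "{y}"] n by auto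
      define y' where "y' = y + (e / 2 / norm a) *\<^sub>R a"
      have yy': "norm (y' - y) = e / 2" using a e by (simp add: y'_def)
      then have "y' \<in> ball y e" using e by (simp add: dist_norm norm_minus_commute)
      then have "y' \<in> \<Omega>" using nbhd y by blast
      moreover have "norm y' \<le> R"
      proof -
        have "norm y' \<le> norm p + norm (y - p) + norm (y' - y)"
          using norm_triangle_ineq[of "p + (y - p)" "y' - y"] norm_triangle_ineq[of p "y - p"] by simp
        then show ?thesis
          using yy' y(1) e R0(1) by (simp add: R_def dist_norm norm_minus_commute)
      qed
      ultimately have "y' \<in> closure \<Omega> \<inter> cball 0 R" using closure_subset by auto
      from hausdorff_distance_lessD(2)[OF hd this]
      obtain x where x: "x \<in> closure (\<Omega>s n)" "dist x y' < e / 2" by blast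
      have "closure (\<Omega>s n) \<subseteq> {x. a \<bullet> x \<le> b}"
        using ab(1) by (intro closure_minimal closed_halfspace_le) auto
      then have "a \<bullet> x \<le> a \<bullet> y" using x(1) ab(2) by auto
      moreover have "a \<bullet> y' = a \<bullet> y + e / 2 * norm a"
        using a by (simp add: y'_def inner_right_distrib power2_norm_eq_inner[symmetric] power2_eq_square)
      ultimately have "e / 2 * norm a \<le> a \<bullet> (y' - x)" by (simp add: inner_diff_right)
      also have "\<dots> \<le> norm a * norm (y' - x)" by (rule norm_cauchy_schwarz)
      also have "\<dots> < norm a * (e / 2)"
        using x(2) a by (intro mult_strict_left_mono) (auto simp: dist_norm norm_minus_commute)
      finally show False by (simp add: mult.commute)
    qed
  qed
qed

lemma local_hausdorff_limit_in_closure: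
  fixes \<Omega> :: "(complex ^ 'd::finite) set"
  assumes conv: "local_hausdorff_converges \<Omega>s \<Omega>" and k: "strict_mono k"
    and x: "\<And>n. x n \<in> closure (\<Omega>s (k n))" and lim: "x \<longlonglongrightarrow> l"
  shows "l \<in> closure \<Omega>"
proof -
  obtain R0 where R0: "0 \<le> R0" "\<And>R. R \<ge> R0 \<Longrightarrow>
      (\<lambda>n. hausdorff_distance (closure (\<Omega>s n) \<inter> cball 0 R) (closure \<Omega> \<inter> cball 0 R)) \<longlonglongrightarrow> 0"
    using conv unfolding local_hausdorff_converges_def by blast
  obtain b where b: "\<And>n. norm (x n) \<le> b"
    using convergent_imp_Bseq[OF convergentI[OF lim]] unfolding Bseq_def by blast
  define R where "R = max R0 b"
  have "l \<in> closure (closure \<Omega>)"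
    unfolding closure_approachable[of l "closure \<Omega>"]
  proof (intro allI impI)
    fix e :: real assume e: "0 < e"
    have "(\<lambda>n. hausdorff_distance (closure (\<Omega>s n) \<inter> cball 0 R) (closure \<Omega> \<inter> cball 0 R)) \<longlonglongrightarrow> 0"
      by (intro R0(2)) (simp add: R_def)
    then have "\<forall>\<^sub>F n in sequentially.
        hausdorff_distance (closure (\<Omega>s n) \<inter> cball 0 R) (closure \<Omega> \<inter> cball 0 R) < ennreal (e / 2)"
      by (rule order_tendstoD) (use e in simp)
    then have "\<forall>\<^sub>F n in sequentially.
        hausdorff_distance (closure (\<Omega>s (k n)) \<inter> cball 0 R) (closure \<Omega> \<inter> cball 0 R) < ennreal (e / 2)"
      by (rule eventually_subseq[OF k])
    moreover have "\<forall>\<^sub>F n in sequentially. dist (x n) l < e / 2"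
      using lim e by (intro tendstoD) auto
    ultimately have "\<forall>\<^sub>F n in sequentially. dist (x n) l < e / 2 \<and>
        hausdorff_distance (closure (\<Omega>s (k n)) \<inter> cball 0 R) (closure \<Omega> \<inter> cball 0 R) < ennreal (e / 2)"
      by eventually_elim simp
    then obtain n where n: "dist (x n) l < e / 2"
      "hausdorff_distance (closure (\<Omega>s (k n)) \<inter> cball 0 R) (closure \<Omega> \<inter> cball 0 R) < ennreal (e / 2)"
      using eventually_happens'[OF sequentially_bot] by blast
    have "norm (x n) \<le> R" using b[of n] by (simp add: R_def)
    then obtain y where "y \<in> closure \<Omega>" "dist (x n) y < e / 2"
      using hausdorff_distance_lessD(1)[OF n(2), of "x n"] x[of n] by auto
    then show "\<exists>y\<in>closure \<Omega>. dist y l < e"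
      using n(1) dist_triangle[of y l "x n"] by (intro bexI[of _ y]) (auto simp: dist_commute)
  qed
  then show ?thesis by simp
qed

lemma eventually_directional_radius_bounded:
  fixes \<Omega> :: "(complex ^ 'd::finite) set"
  assumes conv: "local_hausdorff_converges \<Omega>s \<Omega>"
    and bound: "\<And>v. norm v = 1 \<Longrightarrow> \<exists>c. norm c \<le> b \<and> p + c *s v \<notin> closure \<Omega>"
  shows "\<forall>\<^sub>F n in sequentially. \<forall>v. norm v = 1 \<longrightarrow> (\<exists>c. norm c \<le> b \<and> p + c *s v \<notin> closure (\<Omega>s n))"
proof (rule ccontr)
  assume "\<not> ?thesis"
  then obtain k where k: "strict_mono (k :: nat \<Rightarrow> nat)"
    and "\<forall>n. \<exists>v. norm v = 1 \<and> (\<forall>c. norm c \<le> b \<longrightarrow> p + c *s v \<in> closure (\<Omega>s (k n)))"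
    using not_eventually_sequentiallyD by fastforce
  then obtain v where v: "\<And>n. norm (v n) = 1"
    "\<And>n c. norm c \<le> b \<Longrightarrow> p + c *s v n \<in> closure (\<Omega>s (k n))" by metis
  have "\<forall>n. v n \<in> sphere 0 1" using v(1) by simp
  then obtain u j where u: "u \<in> sphere 0 1" and j: "strict_mono (j::nat\<Rightarrow>nat)" and lim: "(v \<circ> j) \<longlonglongrightarrow> u"
    using compact_sphere[of "0 :: complex ^ 'd" 1] unfolding compact_def by blast
  obtain c where c: "norm c \<le> b" "p + c *s u \<notin> closure \<Omega>"
    using bound[of u] u by auto
  have "p + c *s u \<in> closure \<Omega>"
  proof (rule local_hausdorff_limit_in_closure[OF conv strict_mono_o[OF k j]])
    show "p + c *s v (j n) \<in> closure (\<Omega>s ((k \<circ> j) n))" for n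
      using v(2)[OF c(1), of "j n"] by simp
    show "(\<lambda>n. p + c *s v (j n)) \<longlonglongrightarrow> p + c *s u"
      using lim by (intro tendsto_intros tendsto_vector_smult) (simp add: o_def)
  qed
  with c(2) show False by simp
qed

lemma compact_uniform_inner_point:
  fixes K :: "(complex ^ 'd::finite) set set"
  assumes K: "compactin local_hausdorff_topology K"
  obtains N :: real where "1 \<le> N"
    "\<And>\<Omega>. \<Omega> \<in> K \<Longrightarrow> \<exists>p. norm p \<le> N \<and> cball p (1 / N) \<subseteq> \<Omega> \<and>
       (\<forall>v. norm v = 1 \<longrightarrow> (\<exists>c. norm c \<le> N \<and> p + c *s v \<notin> closure \<Omega>))"
proof -
  define P where "P N \<Omega> \<longleftrightarrow> (\<exists>p. norm p \<le> N \<and> cball p (1 / N) \<subseteq> \<Omega> \<and>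
       (\<forall>v. norm v = 1 \<longrightarrow> (\<exists>c. norm c \<le> N \<and> p + c *s v \<notin> closure \<Omega>)))"
    for N :: real and \<Omega> :: "(complex ^ 'd) set"
  have mono: "P N' \<Omega>" if P: "P N \<Omega>" and N: "1 \<le> N" "N \<le> N'" for N N' \<Omega>
  proof -
    obtain p where p: "norm p \<le> N" "cball p (1 / N) \<subseteq> \<Omega>"
       "\<forall>v. norm v = 1 \<longrightarrow> (\<exists>c. norm c \<le> N \<and> p + c *s v \<notin> closure \<Omega>)"
      using P unfolding P_def by blast
    have "1 / N' \<le> 1 / N" using N by (intro divide_left_mono) auto
    then have "cball p (1 / N') \<subseteq> \<Omega>" using p(2) subset_cball by blast
    moreover have "\<forall>v. norm v = 1 \<longrightarrow> (\<exists>c. norm c \<le> N' \<and> p + c *s v \<notin> closure \<Omega>)"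
      using p(3) N(2) by (meson order_trans)
    ultimately show ?thesis using p(1) N(2) unfolding P_def by (intro exI[of _ p]) auto
  qed
  define G where "G n = {\<Omega> \<in> C_properly_convex_domains. P (real (Suc n)) \<Omega>}" for n
  have "openin local_hausdorff_topology (G n)" for n
    unfolding openin_local_hausdorff_topology
  proof (intro conjI allI impI)
    show "G n \<subseteq> C_properly_convex_domains" by (auto simp: G_def)
    fix \<Omega>s \<Omega>
    assume dom: "range \<Omega>s \<subseteq> C_properly_convex_domains" and \<Omega>: "\<Omega> \<in> G n"
      and conv: "local_hausdorff_converges \<Omega>s \<Omega>"
    obtain p where p: "norm p \<le> real (Suc n)" "cball p (1 / real (Suc n)) \<subseteq> \<Omega>"
       "\<And>v. norm v = 1 \<Longrightarrow> \<exists>c. norm c \<le> real (Suc n) \<and> p + c *s v \<notin> closure \<Omega>"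
      using \<Omega> unfolding G_def P_def by blast
    have "open \<Omega>" using \<Omega> open_properly_convex by (auto simp: G_def)
    then have "\<forall>\<^sub>F i in sequentially. cball p (1 / real (Suc n)) \<subseteq> \<Omega>s i"
      by (rule eventually_cball_subset[OF conv dom _ p(2)])
    moreover have "\<forall>\<^sub>F i in sequentially.
        \<forall>v. norm v = 1 \<longrightarrow> (\<exists>c. norm c \<le> real (Suc n) \<and> p + c *s v \<notin> closure (\<Omega>s i))"
      using conv p(3) by (rule eventually_directional_radius_bounded)
    ultimately show "\<forall>\<^sub>F i in sequentially. \<Omega>s i \<in> G n"
    proof eventually_elim
      case (elim i)
      then show ?case using dom p(1) unfolding G_def P_def by blast
    qed
  qed
  moreover have KX: "K \<subseteq> C_properly_convex_domains"
    using compactin_subset_topspace[OF K] by (simp add: topspace_local_hausdorff_topology)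
  moreover have "K \<subseteq> \<Union> (range G)"
  proof
    fix \<Omega> assume "\<Omega> \<in> K"
    then have \<Omega>: "\<Omega> \<in> C_properly_convex_domains" using KX by blast
    then obtain p where p: "p \<in> \<Omega>" by (auto simp: C_properly_convex_domains_def)
    obtain \<rho> where \<rho>: "0 < \<rho>" "cball p \<rho> \<subseteq> \<Omega>"
      using open_properly_convex[OF \<Omega>] p by (meson open_contains_cball)
    obtain n0 :: nat where n0: "\<forall>v. norm v = 1 \<longrightarrow> (\<exists>c. norm c \<le> real n0 \<and> p + c *s v \<notin> closure \<Omega>)"
      using directional_radius_bounded[OF \<Omega> p] by blast
    obtain n :: nat where n: "norm p + 1 / \<rho> + real n0 \<le> real n" using real_arch_simple by blast
    have \<rho>0: "0 < 1 / \<rho>" using \<rho>(1) by simp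
    have n': "norm p \<le> real (Suc n)" "real n0 \<le> real (Suc n)" "1 / \<rho> \<le> real (Suc n)"
      using n \<rho>0 norm_ge_zero[of p] of_nat_0_le_iff[of n0] unfolding of_nat_Suc by linarith+
    have "1 / real (Suc n) \<le> \<rho>" using n'(3) \<rho>(1) by (simp add: field_simps)
    then have "cball p (1 / real (Suc n)) \<subseteq> \<Omega>" using \<rho>(2) subset_cball by blast
    moreover have "\<forall>v. norm v = 1 \<longrightarrow> (\<exists>c. norm c \<le> real (Suc n) \<and> p + c *s v \<notin> closure \<Omega>)"
      using n0 n'(2) by (meson order_trans)
    ultimately have "\<Omega> \<in> G n" using \<Omega> n'(1) unfolding G_def P_def by blast
    then show "\<Omega> \<in> \<Union> (range G)" by blast
  qed
  ultimately obtain \<F> where \<F>: "finite \<F>" "\<F> \<subseteq> range G" "K \<subseteq> \<Union> \<F>"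
    using K unfolding compactin_def by (metis imageE)
  obtain C where C: "finite C" "\<F> = G ` C" using finite_subset_image[OF \<F>(1,2)] by blast
  define N where "N = real (Suc (\<Sum>C))"
  have "P N \<Omega>" if \<Omega>K: "\<Omega> \<in> K" for \<Omega>
  proof -
    obtain n where n: "n \<in> C" "\<Omega> \<in> G n" using \<F>(3) C(2) \<Omega>K by blast
    have "n \<le> \<Sum>C" using member_le_sum[OF n(1), of "\<lambda>x. x"] C(1) by simp
    then have "real (Suc n) \<le> N" unfolding N_def by (simp only: of_nat_le_iff Suc_le_mono)
    moreover have "P (real (Suc n)) \<Omega>" using n(2) unfolding G_def by blast
    moreover have "1 \<le> real (Suc n)" by simp
    ultimately show ?thesis using mono by blast
  qed
  then have "\<And>\<Omega>. \<Omega> \<in> K \<Longrightarrow> \<exists>p. norm p \<le> N \<and> cball p (1 / N) \<subseteq> \<Omega> \<and>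
      (\<forall>v. norm v = 1 \<longrightarrow> (\<exists>c. norm c \<le> N \<and> p + c *s v \<notin> closure \<Omega>))"
    unfolding P_def .
  moreover have "1 \<le> N" unfolding N_def of_nat_Suc by (simp del: of_nat_sum)
  ultimately show ?thesis using that by blast
qed

section \<open>Iteration along a segment\<close>

lemma disc_radius_bound:
  fixes \<Omega> :: "(complex ^ 'd::finite) set"
  assumes \<Omega>: "convex \<Omega>" and N: "1 \<le> N" and p: "norm p \<le> N" "cball p (1 / N) \<subseteq> \<Omega>"
      "\<And>v. norm v = 1 \<Longrightarrow> \<exists>c. norm c \<le> N \<and> p + c *s v \<notin> closure \<Omega>"
    and w: "norm w \<le> R" and disc: "\<And>c. norm c < 1 \<Longrightarrow> w + c *s u \<in> \<Omega>"
    and \<epsilon>: "0 < \<epsilon>" "\<epsilon> * (R + N) \<le> 1 / N"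
  shows "norm u \<le> N * (1 + \<epsilon>) / \<epsilon>"
proof (rule ccontr)
  define t where "t = \<epsilon> / (1 + \<epsilon>)"
  have t: "0 < t" using \<epsilon> by (simp add: t_def)
  assume "\<not> ?thesis"
  then have ut: "N < t * norm u" using \<epsilon>(1) by (simp add: t_def field_simps)
  then have u: "0 < norm u" using N t by (metis less_le_trans zero_less_one zero_less_mult_pos order_less_trans)
  obtain c where c: "norm c \<le> N" "p + c *s (u /\<^sub>R norm u) \<notin> closure \<Omega>"
    using p(3)[of "u /\<^sub>R norm u"] u by auto
  define c' where "c' = c / of_real (t * norm u)"
  have "norm c' < 1" using c(1) ut u t by (simp add: c'_def norm_divide norm_mult)
  then have 1: "w + c' *s u \<in> \<Omega>" by (rule disc)
  have "p + \<epsilon> *\<^sub>R (p - w) \<in> cball p (1 / N)"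
  proof -
    have "\<epsilon> * norm (p - w) \<le> \<epsilon> * (R + N)"
      using \<epsilon>(1) norm_triangle_ineq4[of p w] p(1) w by (intro mult_left_mono) auto
    then show ?thesis using \<epsilon> by (simp add: dist_norm order_trans[OF _ \<epsilon>(2)])
  qed
  then have 2: "p + \<epsilon> *\<^sub>R (p - w) \<in> \<Omega>" using p(2) by blast
  have t': "1 - t = 1 / (1 + \<epsilon>)" "(1 - t) * \<epsilon> = t" "0 \<le> 1 - t"
    using \<epsilon>(1) by (auto simp: t_def field_simps)
  have "(1 - t) *\<^sub>R (p + \<epsilon> *\<^sub>R (p - w)) + t *\<^sub>R (w + c' *s u) \<in> \<Omega>"
    using 1 2 t t' by (intro convexD[OF \<Omega>]) auto
  also have "(1 - t) *\<^sub>R (p + \<epsilon> *\<^sub>R (p - w)) + t *\<^sub>R (w + c' *s u)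
      = (1 - t) *\<^sub>R p + ((1 - t) * \<epsilon>) *\<^sub>R (p - w) + t *\<^sub>R w + t *\<^sub>R (c' *s u)"
    by (simp add: scaleR_right_distrib)
  also have "\<dots> = p + t *\<^sub>R (c' *s u)"
    unfolding t'(2) by (simp add: algebra_simps)
  also have "t *\<^sub>R (c' *s u) = c *s (u /\<^sub>R norm u)"
    using t u by (simp add: scaleR_eq_vector_smult vector_smult_assoc c'_def field_simps)
  finally show False using c(2) closure_subset by blast
qed

lemma directional_disc_subset:
  fixes \<Omega> :: "(complex ^ 'd::finite) set"
  assumes z: "z \<in> \<Omega>" and c: "norm (c *s v) < directional_boundary_distance \<Omega> z v"
  shows "z + c *s v \<in> \<Omega>"
proof (rule ccontr)
  assume "z + c *s v \<notin> \<Omega>"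
  then have "closed_segment z (z + c *s v) \<inter> frontier \<Omega> \<noteq> {}"
    using z by (intro connected_Int_frontier) auto
  then obtain t where t: "0 \<le> t" "t \<le> 1" and mem: "z + t *\<^sub>R (c *s v) \<in> frontier \<Omega>"
    by (auto simp: in_segment algebra_simps)
  have "z + t *\<^sub>R (c *s v) \<in> complex_line z v"
    unfolding complex_line_def by (auto simp: scaleR_eq_vector_smult vector_smult_assoc)
  then have "directional_boundary_distance \<Omega> z v \<le> dist z (z + t *\<^sub>R (c *s v))"
    unfolding directional_boundary_distance_def using mem by (intro infdist_le) auto
  also have "\<dots> \<le> norm (c *s v)"
    using t by (simp add: dist_norm mult_left_le_one_le)
  finally show False using c by simp
qed

lemma boundary_distance_ge:
  assumes "open \<Omega>" "frontier \<Omega> \<noteq> {}" "ball z s \<subseteq> \<Omega>"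
  shows "s \<le> boundary_distance \<Omega> z"
  unfolding boundary_distance_def infdist_notempty[OF assms(2)]
proof (rule cINF_greatest[OF assms(2)])
  fix x assume "x \<in> frontier \<Omega>"
  then have "x \<notin> \<Omega>" using assms(1) by (simp add: frontier_def interior_open)
  then show "s \<le> dist z x" using assms(3) by (auto simp: not_less[symmetric])
qed

lemma disc_growth:
  fixes \<Omega> :: "(complex ^ 'd::finite) set"
  assumes op: "open \<Omega>" and cv: "convex \<Omega>" and p: "cball p \<rho> \<subseteq> \<Omega>" and \<rho>: "0 < \<rho>"
    and \<xi>: "\<xi> \<in> frontier \<Omega>" and c0: "0 < c0" "c0 * norm (p - \<xi>) \<le> \<rho>" and M: "1 < M"
    and double: "\<And>z u c. z \<in> \<Omega> \<Longrightarrow> (\<And>c. norm c < c0 \<Longrightarrow> z + c *s (\<xi> - z) \<in> \<Omega>) \<Longrightarrow>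
      (\<And>c. norm c < 1 \<Longrightarrow> \<xi> + (1 / M) *\<^sub>R (z - \<xi>) + c *s u \<in> \<Omega>) \<Longrightarrow> norm c < 1 \<Longrightarrow>
      z + (2 * c) *s u \<in> \<Omega>"
    and s: "0 < s" and disc: "\<And>c. norm c < 1 \<Longrightarrow> \<xi> + s *\<^sub>R (p - \<xi>) + c *s u \<in> \<Omega>"
  shows "M ^ k * s \<le> 1 \<Longrightarrow> norm c < 1 \<Longrightarrow> \<xi> + (M ^ k * s) *\<^sub>R (p - \<xi>) + c *s (2 ^ k *\<^sub>R u) \<in> \<Omega>"
proof (induction k arbitrary: c)
  case 0
  then show ?case using disc by simp
next
  case (Suc k)
  define \<sigma> where "\<sigma> = M ^ Suc k * s"
  define w where "w = \<xi> + \<sigma> *\<^sub>R (p - \<xi>)"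
  have \<sigma>: "0 < \<sigma>" "\<sigma> \<le> 1" using Suc.prems(1) s M by (auto simp: \<sigma>_def)
  have \<xi>c: "\<xi> \<in> closure \<Omega>" using \<xi> by (simp add: frontier_def)
  have cone: "w + \<sigma> *\<^sub>R y \<in> \<Omega>" if "norm y \<le> \<rho>" for y
  proof -
    have "p + y \<in> \<Omega>" using p that by (auto simp: dist_norm)
    then have "\<xi> + \<sigma> *\<^sub>R ((p + y) - \<xi>) \<in> \<Omega>"
      using op cv \<xi>c \<sigma> by (intro open_convex_closure_combination) auto
    then show ?thesis by (simp add: w_def algebra_simps)
  qed
  have "M ^ k * s \<le> M * (M ^ k * s)" using M s by simp
  then have IH: "\<xi> + (M ^ k * s) *\<^sub>R (p - \<xi>) + c *s (2 ^ k *\<^sub>R u) \<in> \<Omega>" if "norm c < 1" for c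
    using Suc that by (simp add: mult.assoc)
  have "w + (2 * c) *s (2 ^ k *\<^sub>R u) \<in> \<Omega>"
  proof (rule double)
    show "w \<in> \<Omega>" using cone[of 0] \<rho> by simp
    show "w + c *s (\<xi> - w) \<in> \<Omega>" if c: "norm c < c0" for c
    proof -
      have "norm (c *s (p - \<xi>)) \<le> c0 * norm (p - \<xi>)"
        using c unfolding norm_vector_smult by (intro mult_right_mono) auto
      then have "w + \<sigma> *\<^sub>R (- (c *s (p - \<xi>))) \<in> \<Omega>" using c0(2)
        by (intro cone) (simp only: norm_minus_cancel)
      also have "\<sigma> *\<^sub>R (- (c *s (p - \<xi>))) = c *s (\<xi> - w)"
        by (simp add: w_def scaleR_eq_vector_smult vector_smult_assoc vec_eq_iff)
      finally show ?thesis .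
    qed
    show "\<xi> + (1 / M) *\<^sub>R (w - \<xi>) + c *s (2 ^ k *\<^sub>R u) \<in> \<Omega>" if "norm c < 1" for c
    proof -
      have "(1 / M) *\<^sub>R (w - \<xi>) = (M ^ k * s) *\<^sub>R (p - \<xi>)"
        using M by (simp add: w_def \<sigma>_def)
      then show ?thesis using IH[OF that] by simp
    qed
  qed fact
  moreover have "(2 * c) *s (2 ^ k *\<^sub>R u) = c *s (2 ^ Suc k *\<^sub>R u)"
    by (simp add: scaleR_eq_vector_smult vector_smult_assoc mult_ac)
  ultimately show ?case by (simp add: w_def \<sigma>_def)
qed

lemma power_gap:
  fixes M s :: real
  assumes "1 < M" "0 < s" "s \<le> 1"
  obtains k where "M ^ k * s \<le> 1" "1 < M ^ Suc k * s"
proof -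
  obtain n where "1 / s < M ^ n" using real_arch_pow[OF assms(1)] by blast
  then have n: "1 < M ^ n * s" using assms by (simp add: field_simps)
  define l where "l = (LEAST n. 1 < M ^ n * s)"
  have l: "1 < M ^ l * s" unfolding l_def by (rule LeastI[of _ n]) (rule n)
  then have "l \<noteq> 0" using assms(3) by (intro notI) simp
  then obtain k where k: "l = Suc k" by (auto simp: gr0_conv_Suc)
  have "\<not> 1 < M ^ k * s" using not_less_Least[of k "\<lambda>n. 1 < M ^ n * s"] k by (simp add: l_def)
  then show ?thesis using l k that by (simp add: not_less)
qed

lemma inverse_power_two_bound:
  fixes M s :: real
  assumes M: "2 \<le> M" and s: "0 < s" and k: "1 < M ^ Suc k * s"
  shows "1 / 2 ^ k \<le> 2 * s powr (1 / log 2 M)"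
proof -
  define m where "m = log 2 M"
  have m: "1 \<le> m" using M by (simp add: m_def le_log_iff)
  have "1 \<le> (M ^ Suc k * s) powr (1 / m)"
    using k m by (intro ge_one_powr_ge_zero) auto
  also have "\<dots> = (M powr real (Suc k)) powr (1 / m) * s powr (1 / m)"
    using M s by (subst powr_mult) (auto simp: powr_realpow simp del: power_Suc of_nat_Suc)
  also have "(M powr real (Suc k)) powr (1 / m) = (M powr (1 / m)) powr real (Suc k)"
    by (simp only: powr_powr mult.commute)
  also have "M powr (1 / m) = 2"
  proof -
    have "M = 2 powr m" using M by (simp add: m_def)
    have "(2 powr m) powr (1 / m) = (2 :: real)" using m by (simp add: powr_powr)
    with \<open>M = 2 powr m\<close> show ?thesis by (simp only:)
  qed
  also have "2 powr real (Suc k) = (2 :: real) ^ Suc k" by (rule powr_realpow) simp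
  finally show ?thesis unfolding m_def[symmetric] by (simp add: field_simps)
qed

theorem theorem6p1:
  fixes K :: "(complex ^ 'd::finite) set set" and R :: real
  assumes "compactin local_hausdorff_topology K"
    and "\<forall>D \<in> affine_orbit_closure K. simple_boundary D"
    and "R > 0"
  shows "\<exists>C>0. \<exists>m::real. m \<ge> 1 \<and>
           (\<forall>\<Omega>\<in>K. \<forall>z\<in>\<Omega>. \<forall>v. norm z < R \<longrightarrow> v \<noteq> 0 \<longrightarrow>
              directional_boundary_distance \<Omega> z v \<le> C * boundary_distance \<Omega> z powr (1 / m))"
proof -
  have KX: "K \<subseteq> C_properly_convex_domains"
    using compactin_subset_topspace[OF assms(1)] by (simp add: topspace_local_hausdorff_topology)
  obtain N :: real where N: "1 \<le> N"
    and inner: "\<And>\<Omega>. \<Omega> \<in> K \<Longrightarrow> \<exists>p. norm p \<le> N \<and> cball p (1 / N) \<subseteq> \<Omega> \<and>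
       (\<forall>v. norm v = 1 \<longrightarrow> (\<exists>c. norm c \<le> N \<and> p + c *s v \<notin> closure \<Omega>))"
    using compact_uniform_inner_point[OF assms(1)] by blast
  define H where "H = 2 * (R + N)"
  define c0 where "c0 = 1 / N / H"
  have H: "0 < H" and c0: "0 < c0" using N assms(3) by (auto simp: H_def c0_def)
  obtain M where M: "2 \<le> M" and double: "\<forall>\<Omega>\<in>K. \<forall>z\<in>\<Omega>. \<forall>\<xi>\<in>frontier \<Omega>. \<forall>u.
    (\<forall>c. norm c < c0 \<longrightarrow> z + c *s (\<xi> - z) \<in> \<Omega>) \<longrightarrow>
    (\<forall>c. norm c < 1 \<longrightarrow> \<xi> + (1 / M) *\<^sub>R (z - \<xi>) + c *s u \<in> \<Omega>) \<longrightarrow>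
    (\<forall>c. norm c < 1 \<longrightarrow> z + (2 * c) *s u \<in> \<Omega>)"
    using disc_doubling[OF KX _ c0] assms(2) by blast
  define m where "m = log 2 M"
  define R' where "R' = N + H"
  define \<epsilon> where "\<epsilon> = 1 / N / (R' + N)"
  define C0 where "C0 = N * (1 + \<epsilon>) / \<epsilon>"
  define C where "C = 2 * C0 * (2 * N) powr (1 / m)"
  have m: "1 \<le> m" using M by (simp add: m_def le_log_iff)
  have R': "R \<le> R'" "0 < R' + N" using N assms(3) by (auto simp: R'_def H_def)
  then have \<epsilon>: "0 < \<epsilon>" "\<epsilon> * (R' + N) \<le> 1 / N" using N by (auto simp: \<epsilon>_def)
  have C0: "0 < C0" using N \<epsilon> by (auto simp: C0_def intro!: divide_pos_pos mult_pos_pos)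
  then have C: "0 < C" using N by (simp add: C_def)
  have "directional_boundary_distance \<Omega> z v \<le> C * boundary_distance \<Omega> z powr (1 / m)"
    if \<Omega>K: "\<Omega> \<in> K" and z: "z \<in> \<Omega>" and zR: "norm z < R" and v: "v \<noteq> 0" for \<Omega> z v
  proof -
    have \<Omega>: "\<Omega> \<in> C_properly_convex_domains" using \<Omega>K KX by blast
    note op = open_properly_convex[OF \<Omega>] and cv = convex_properly_convex[OF \<Omega>]
    obtain p where p: "norm p \<le> N" "cball p (1 / N) \<subseteq> \<Omega>"
       "\<And>v. norm v = 1 \<Longrightarrow> \<exists>c. norm c \<le> N \<and> p + c *s v \<notin> closure \<Omega>"
      using inner[OF \<Omega>K] by blast
    define r where "r = directional_boundary_distance \<Omega> z v"
    define \<delta> where "\<delta> = boundary_distance \<Omega> z"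
    have \<delta>0: "0 \<le> \<delta>" and r0: "0 \<le> r"
      by (simp_all add: \<delta>_def r_def boundary_distance_def directional_boundary_distance_def infdist_nonneg)
    have "\<Omega> \<noteq> UNIV" using \<Omega> v unfolding C_properly_convex_domains_def by auto
    then have fr: "frontier \<Omega> \<noteq> {}" using z by (auto simp: frontier_eq_empty)
    define u where "u = (r / norm v) *\<^sub>R v"
    have nu: "norm u = r" using v r0 by (simp add: u_def)
    have disc: "z + c *s u \<in> \<Omega>" if c: "norm c < 1" for c
    proof (cases "r = 0")
      case True
      then show ?thesis using z by (simp add: u_def)
    next
      case False
      have eq: "c *s u = (c * of_real (r / norm v)) *s v"
        by (simp only: u_def scaleR_eq_vector_smult vector_smult_assoc)
      have "norm (c *s u) < r"
        using c False r0 by (simp add: norm_vector_smult nu)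
      then show ?thesis
        unfolding eq r_def by (rule directional_disc_subset[OF z])
    qed
    have bound: "norm u' \<le> C0" if "norm w \<le> R'" "\<And>c. norm c < 1 \<Longrightarrow> w + c *s u' \<in> \<Omega>" for w u'
      unfolding C0_def using disc_radius_bound[OF cv N p that \<epsilon>] .
    have C\<delta>: "C * \<delta> powr (1 / m) = 2 * C0 * (2 * N * \<delta>) powr (1 / m)"
      using N \<delta>0 by (simp add: C_def powr_mult)
    have "r \<le> C * \<delta> powr (1 / m)"
    proof (cases "1 / (2 * N) \<le> \<delta>")
      case True
      then have "1 \<le> (2 * N * \<delta>) powr (1 / m)"
        using N m by (intro ge_one_powr_ge_zero) (auto simp: field_simps)
      then have "C0 * 1 \<le> 2 * C0 * (2 * N * \<delta>) powr (1 / m)"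
        using C0 by (intro mult_mono) auto
      moreover have "r \<le> C0" using bound[of z u] disc zR R'(1) nu by simp
      ultimately show ?thesis unfolding C\<delta> by simp
    next
      case False
      have far: "2 *\<^sub>R z - p \<notin> closure \<Omega>"
      proof
        assume mem: "2 *\<^sub>R z - p \<in> closure \<Omega>"
        have "ball z (1 / (2 * N)) \<subseteq> \<Omega>"
        proof
          fix y assume "y \<in> ball z (1 / (2 * N))"
          then have "norm (2 *\<^sub>R (y - z)) \<le> 1 / N"
            by (simp add: dist_norm norm_minus_commute)
          then have "p + 2 *\<^sub>R (y - z) \<in> \<Omega>" using p(2) by (auto simp: dist_norm)
          then have "(2 *\<^sub>R z - p) + (1/2) *\<^sub>R ((p + 2 *\<^sub>R (y - z)) - (2 *\<^sub>R z - p)) \<in> \<Omega>"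
            using op cv mem by (intro open_convex_closure_combination) auto
          also have "(2 *\<^sub>R z - p) + (1/2) *\<^sub>R ((p + 2 *\<^sub>R (y - z)) - (2 *\<^sub>R z - p)) = y"
            by (simp add: vec_eq_iff scaleR_conv_of_real[of _ "_ :: complex"] algebra_simps)
          finally show "y \<in> \<Omega>" .
        qed
        then show False using boundary_distance_ge[OF op fr] False by (auto simp: \<delta>_def)
      qed
      have "closed_segment z (2 *\<^sub>R z - p) \<inter> frontier \<Omega> \<noteq> {}"
        using z far closure_subset by (intro connected_Int_frontier) auto
      then obtain \<xi> where \<xi>: "\<xi> \<in> frontier \<Omega>" and seg: "\<xi> \<in> closed_segment z (2 *\<^sub>R z - p)"
        by blast
      then obtain t where t: "0 \<le> t" "t \<le> 1"
        and "\<xi> = (1 - t) *\<^sub>R z + t *\<^sub>R (2 *\<^sub>R z - p)"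
        by (auto simp: in_segment)
      then have \<xi>_eq: "\<xi> = z + t *\<^sub>R (z - p)"
        by (simp add: vec_eq_iff scaleR_conv_of_real[of _ "_ :: complex"] algebra_simps)
      have "t \<noteq> 0"
        using \<xi> \<xi>_eq z op by (auto simp: frontier_def interior_open)
      define s where "s = t / (1 + t)"
      have s: "0 < s" "s \<le> 1" "s * (1 + t) = t" using t \<open>t \<noteq> 0\<close> by (auto simp: s_def)
      have \<xi>p: "p - \<xi> = - ((1 + t) *\<^sub>R (z - p))" by (simp add: \<xi>_eq algebra_simps)
      have z_eq: "\<xi> + s *\<^sub>R (p - \<xi>) = z"
        unfolding \<xi>p using s(3) by (simp add: \<xi>_eq)
      have \<xi>H: "norm (p - \<xi>) \<le> H"
      proof -
        have "norm (p - \<xi>) = (1 + t) * norm (z - p)" using t unfolding \<xi>p by simp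
        also have "\<dots> \<le> 2 * (R + N)"
          using t norm_triangle_ineq4[of z p] zR p(1) by (intro mult_mono) auto
        finally show ?thesis by (simp add: H_def)
      qed
      have "s * (1 / N) \<le> \<delta>"
        unfolding \<delta>_def
      proof (rule boundary_distance_ge[OF op fr], rule subsetI)
        fix y assume y: "y \<in> ball z (s * (1 / N))"
        have "norm ((y - z) /\<^sub>R s) \<le> 1 / N"
        proof -
          have "norm ((y - z) /\<^sub>R s) = norm (y - z) / s"
            using s by (simp add: divide_inverse_commute)
          also have "\<dots> \<le> 1 / N"
            using y s N by (simp add: dist_norm norm_minus_commute pos_divide_le_eq mult.commute)
          finally show ?thesis .
        qed
        then have "p + (y - z) /\<^sub>R s \<in> \<Omega>" using p(2) by (auto simp: dist_norm)
        then have "\<xi> + s *\<^sub>R ((p + (y - z) /\<^sub>R s) - \<xi>) \<in> \<Omega>"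
          using op cv \<xi> s by (intro open_convex_closure_combination) (auto simp: frontier_def)
        also have "\<xi> + s *\<^sub>R ((p + (y - z) /\<^sub>R s) - \<xi>) = (\<xi> + s *\<^sub>R (p - \<xi>)) + (y - z)"
          using s(1) by (simp add: algebra_simps)
        finally show "y \<in> \<Omega>" by (simp add: z_eq)
      qed
      then have "s \<le> N * \<delta>" using N by (simp add: field_simps)
      moreover have "0 \<le> N * \<delta>" using N \<delta>0 by simp
      ultimately have sN: "s \<le> 2 * N * \<delta>" by linarith
      obtain k where k: "M ^ k * s \<le> 1" "1 < M ^ Suc k * s"
        using power_gap[of M s] M s by auto
      define w where "w = \<xi> + (M ^ k * s) *\<^sub>R (p - \<xi>)"
      have "norm w \<le> R'"
      proof -
        have "w = p - (1 - M ^ k * s) *\<^sub>R (p - \<xi>)" by (simp add: w_def algebra_simps)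
        then have "norm w \<le> norm p + norm ((1 - M ^ k * s) *\<^sub>R (p - \<xi>))"
          using norm_triangle_ineq4 by metis
        also have "norm ((1 - M ^ k * s) *\<^sub>R (p - \<xi>)) \<le> 1 * norm (p - \<xi>)"
          unfolding norm_scaleR using k(1) M s by (intro mult_right_mono) auto
        finally show ?thesis using p(1) \<xi>H by (simp add: R'_def)
      qed
      then have "norm (2 ^ k *\<^sub>R u) \<le> C0"
      proof (rule bound)
        fix c :: complex assume c: "norm c < 1"
        show "w + c *s (2 ^ k *\<^sub>R u) \<in> \<Omega>"
          unfolding w_def
        proof (rule disc_growth[OF op cv p(2) _ \<xi> c0])
          show "c0 * norm (p - \<xi>) \<le> 1 / N"
            using mult_left_mono[OF \<xi>H, of c0] c0 H by (simp add: c0_def)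
          show "\<xi> + s *\<^sub>R (p - \<xi>) + c *s u \<in> \<Omega>" if "norm c < 1" for c
            using disc[OF that] by (simp add: z_eq)
          show "z + (2 * c) *s u \<in> \<Omega>"
            if "z \<in> \<Omega>" "\<And>c. norm c < c0 \<Longrightarrow> z + c *s (\<xi> - z) \<in> \<Omega>"
              "\<And>c. norm c < 1 \<Longrightarrow> \<xi> + (1 / M) *\<^sub>R (z - \<xi>) + c *s u \<in> \<Omega>" "norm c < 1" for z u c
            using double[rule_format, OF \<Omega>K that(1) \<xi> that(2,3,4)] .
        qed (use N M s k c in auto)
      qed
      then have "r \<le> C0 * (1 / 2 ^ k)" by (simp add: nu field_simps)
      also have "\<dots> \<le> C0 * (2 * s powr (1 / m))"
        using inverse_power_two_bound[OF M s(1) k(2)] C0 by (intro mult_left_mono) (auto simp: m_def)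
      also have "\<dots> \<le> C0 * (2 * (2 * N * \<delta>) powr (1 / m))"
        using C0 sN s m by (intro mult_left_mono powr_mono2) auto
      finally show ?thesis unfolding C\<delta> by simp
    qed
    then show ?thesis by (simp add: r_def \<delta>_def)
  qed
  then show ?thesis using C m by blast
qed

end
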